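(* For each integer $k>0$, the group $$P_k=\langle a, b \mid ab^{2^k}a^{-1}b^{2^k},\; ba^2b^{-1}a^2 \rangle$$ is torsion-free and does not satisfy the unique product property. Moreover, for each integer $k>1$, the group $P_k$ does not contain $P$ (that is, no subgroup of $P_k$ is isomorphic to $P$), where $P = \langle x, y \mid xy^2x^{-1}y^2,\; yx^2y^{-1}x^2 \rangle$.
   Context: A group $G$ satisfies the unique product property if, for any two non-empty finite subsets $X, Y \subset G$, at least one element $z$ of the product set $XY=\{xy \mid x\in X,\ y\in Y\}$ can be written uniquely as a product $z=xy$ with $x\in X$ and $y\in Y$. *)

theory Defs
  imports "HOL-Algebra.Generated_Groups"
begin

section \<open>Free groups and group presentations\<close>

text \<open>A letter is a generator together with a sign: \<open>(g, True)\<close> stands for \<open>g\<close> and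
  \<open>(g, False)\<close> for its formal inverse.\<close>

type_synonym 'g word = "('g \<times> bool) list"

inductive cancel_eq :: "'g word \<Rightarrow> 'g word \<Rightarrow> bool" where
  refl: "cancel_eq u u"
| sym: "cancel_eq u v \<Longrightarrow> cancel_eq v u"
| trans: "cancel_eq u v \<Longrightarrow> cancel_eq v w \<Longrightarrow> cancel_eq u w"
| cancel: "cancel_eq (u @ [(g, e), (g, \<not> e)] @ v) (u @ v)"

definition cancel_rel :: "('g word \<times> 'g word) set" where
  "cancel_rel = {(u, v). cancel_eq u v}"

text \<open>The free group on all elements of the type \<open>'g\<close>.\<close>

definition free_group :: "'g word set monoid" where
  "free_group = \<lparr>carrier = UNIV // cancel_rel,
     monoid.mult = (\<lambda>A B. \<Union>u\<in>A. \<Union>v\<in>B. cancel_rel `` {u @ v}),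
     monoid.one = cancel_rel `` {[]}\<rparr>"

definition free_gen :: "'g \<Rightarrow> 'g word set" where
  "free_gen g = cancel_rel `` {[(g, True)]}"

definition normal_closure :: "('a, 'm) monoid_scheme \<Rightarrow> 'a set \<Rightarrow> 'a set" where
  "normal_closure G R =
     generate G {g \<otimes>\<^bsub>G\<^esub> r \<otimes>\<^bsub>G\<^esub> inv\<^bsub>G\<^esub> g | g r. g \<in> carrier G \<and> r \<in> R}"

definition presented_group :: "'g word set set \<Rightarrow> 'g word set set monoid" where
  "presented_group R = free_group Mod normal_closure free_group R"

lemma equiv_cancel_rel: "equiv UNIV cancel_rel"
  by (auto simp: equiv_def refl_on_def sym_def trans_def cancel_rel_def
      intro: cancel_eq.intros)

lemma cancel_eq_append_left: "cancel_eq u v \<Longrightarrow> cancel_eq (w @ u) (w @ v)"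
proof (induction rule: cancel_eq.induct)
  case (cancel u g e v)
  show ?case using cancel_eq.cancel[of "w @ u" g e v] by simp
qed (auto intro: cancel_eq.intros)

lemma cancel_eq_append_right: "cancel_eq u v \<Longrightarrow> cancel_eq (u @ w) (v @ w)"
proof (induction rule: cancel_eq.induct)
  case (cancel u g e v)
  show ?case using cancel_eq.cancel[of u g e "v @ w"] by simp
qed (auto intro: cancel_eq.intros)

lemma cancel_eq_append:
  "cancel_eq u u' \<Longrightarrow> cancel_eq v v' \<Longrightarrow> cancel_eq (u @ v) (u' @ v')"
  by (meson cancel_eq.trans cancel_eq_append_left cancel_eq_append_right)

lemma free_group_mult:
  "(cancel_rel `` {u}) \<otimes>\<^bsub>free_group\<^esub> (cancel_rel `` {v}) = cancel_rel `` {u @ v}"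
proof -
  have "congruent2 cancel_rel cancel_rel (\<lambda>u v. cancel_rel `` {u @ v})"
    unfolding congruent2_def
    using cancel_eq_append equiv_class_eq[OF equiv_cancel_rel]
    by (fastforce simp: cancel_rel_def)
  from UN_equiv_class2[OF equiv_cancel_rel equiv_cancel_rel this]
  show ?thesis by (simp add: free_group_def)
qed

lemma free_group_one: "\<one>\<^bsub>free_group\<^esub> = cancel_rel `` {[]}"
  by (simp add: free_group_def)

lemma free_group_class_in_carrier: "cancel_rel `` {u} \<in> carrier free_group"
  by (simp add: free_group_def quotientI)

lemma free_group_carrierE:
  assumes "A \<in> carrier free_group"
  obtains u where "A = cancel_rel `` {u}"
  using assms by (auto simp: free_group_def elim: quotientE)

lemma cancel_eq_inverse: "cancel_eq (map (\<lambda>(g, e). (g, \<not> e)) (rev u) @ u) []"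
proof (induction u)
  case (Cons x u)
  obtain g e where x: "x = (g, e)" by (cases x)
  show ?case
    using cancel_eq.cancel[of "map (\<lambda>(g, e). (g, \<not> e)) (rev u)" g "\<not> e" u] Cons
    by (auto simp: x intro: cancel_eq.trans)
qed (simp add: cancel_eq.refl)

lemma group_free_group: "group free_group"
proof (rule groupI)
  fix A :: "'g word set" assume "A \<in> carrier free_group"
  then obtain u where u: "A = cancel_rel `` {u}" by (rule free_group_carrierE)
  have "cancel_rel `` {map (\<lambda>(g, e). (g, \<not> e)) (rev u)} \<otimes>\<^bsub>free_group\<^esub> A = \<one>\<^bsub>free_group\<^esub>"
    unfolding u free_group_mult free_group_one
    by (rule equiv_class_eq[OF equiv_cancel_rel]) (simp add: cancel_rel_def cancel_eq_inverse)
  then show "\<exists>B\<in>carrier free_group. B \<otimes>\<^bsub>free_group\<^esub> A = \<one>\<^bsub>free_group\<^esub>"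
    using free_group_class_in_carrier by blast
qed (auto elim!: free_group_carrierE
      simp: free_group_mult free_group_one free_group_class_in_carrier)

lemma free_gen_in_carrier: "free_gen g \<in> carrier free_group"
  by (simp add: free_gen_def free_group_class_in_carrier)

lemma (in group) normal_closure_normal:
  assumes R: "R \<subseteq> carrier G"
  shows "normal_closure G R \<lhd> G"
  unfolding normal_closure_def
proof (rule normal_generateI)
  fix h g
  assume "h \<in> {g \<otimes> r \<otimes> inv g | g r. g \<in> carrier G \<and> r \<in> R}" and g: "g \<in> carrier G"
  then obtain x r where h: "h = x \<otimes> r \<otimes> inv x" "x \<in> carrier G" "r \<in> R" by blast
  then have "g \<otimes> h \<otimes> inv g = (g \<otimes> x) \<otimes> r \<otimes> inv (g \<otimes> x)"
    using R g by (auto simp: m_assoc inv_mult_group subset_iff)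
  with h g show "g \<otimes> h \<otimes> inv g \<in> {g \<otimes> r \<otimes> inv g | g r. g \<in> carrier G \<and> r \<in> R}"
    by blast
qed (use R in auto)

lemma group_presented_group:
  "R \<subseteq> carrier free_group \<Longrightarrow> group (presented_group R)"
  unfolding presented_group_def
  by (intro normal.factorgroup_is_group group.normal_closure_normal group_free_group)


section \<open>Torsion-freeness and the unique product property\<close>

definition torsion_free :: "('a, 'm) monoid_scheme \<Rightarrow> bool" where
  "torsion_free G \<longleftrightarrow>
     (\<forall>x\<in>carrier G. \<forall>n::nat. n > 0 \<longrightarrow> x [^]\<^bsub>G\<^esub> n = \<one>\<^bsub>G\<^esub> \<longrightarrow> x = \<one>\<^bsub>G\<^esub>)"

definition unique_product_property :: "('a, 'm) monoid_scheme \<Rightarrow> bool" where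
  "unique_product_property G \<longleftrightarrow>
     (\<forall>X Y. X \<subseteq> carrier G \<longrightarrow> Y \<subseteq> carrier G \<longrightarrow> finite X \<longrightarrow> finite Y \<longrightarrow>
        X \<noteq> {} \<longrightarrow> Y \<noteq> {} \<longrightarrow>
        (\<exists>z \<in> X <#>\<^bsub>G\<^esub> Y. \<exists>!p. p \<in> X \<times> Y \<and> z = fst p \<otimes>\<^bsub>G\<^esub> snd p))"


section \<open>The groups \<open>P\<^sub>k\<close> and \<open>P\<close>\<close>

datatype gens_ab = gen_a | gen_b

definition P_k_relators :: "nat \<Rightarrow> gens_ab word set set" where
  "P_k_relators k =
     (let F = free_group; a = free_gen gen_a; b = free_gen gen_b in
      {a \<otimes>\<^bsub>F\<^esub> b [^]\<^bsub>F\<^esub> ((2::nat) ^ k) \<otimes>\<^bsub>F\<^esub> inv\<^bsub>F\<^esub> a \<otimes>\<^bsub>F\<^esub> b [^]\<^bsub>F\<^esub> ((2::nat) ^ k),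
       b \<otimes>\<^bsub>F\<^esub> a [^]\<^bsub>F\<^esub> (2::nat) \<otimes>\<^bsub>F\<^esub> inv\<^bsub>F\<^esub> b \<otimes>\<^bsub>F\<^esub> a [^]\<^bsub>F\<^esub> (2::nat)})"

definition P_k :: "nat \<Rightarrow> gens_ab word set set monoid" where
  "P_k k = presented_group (P_k_relators k)"

datatype gens_xy = gen_x | gen_y

definition P_relators :: "gens_xy word set set" where
  "P_relators =
     (let F = free_group; x = free_gen gen_x; y = free_gen gen_y in
      {x \<otimes>\<^bsub>F\<^esub> y [^]\<^bsub>F\<^esub> (2::nat) \<otimes>\<^bsub>F\<^esub> inv\<^bsub>F\<^esub> x \<otimes>\<^bsub>F\<^esub> y [^]\<^bsub>F\<^esub> (2::nat),
       y \<otimes>\<^bsub>F\<^esub> x [^]\<^bsub>F\<^esub> (2::nat) \<otimes>\<^bsub>F\<^esub> inv\<^bsub>F\<^esub> y \<otimes>\<^bsub>F\<^esub> x [^]\<^bsub>F\<^esub> (2::nat)})"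

definition P_group :: "gens_xy word set set monoid" where
  "P_group = presented_group P_relators"

lemma P_k_relators_in_carrier: "P_k_relators k \<subseteq> carrier free_group"
proof -
  interpret F: group "free_group :: gens_ab word set monoid" by (rule group_free_group)
  show ?thesis
    unfolding P_k_relators_def Let_def
    by (intro insert_subsetI empty_subsetI F.m_closed F.inv_closed F.nat_pow_closed
        free_gen_in_carrier)
qed

lemma P_relators_in_carrier: "P_relators \<subseteq> carrier free_group"
proof -
  interpret F: group "free_group :: gens_xy word set monoid" by (rule group_free_group)
  show ?thesis
    unfolding P_relators_def Let_def
    by (intro insert_subsetI empty_subsetI F.m_closed F.inv_closed F.nat_pow_closed
        free_gen_in_carrier)
qed

lemma group_P_k: "group (P_k k)"
  unfolding P_k_def by (rule group_presented_group[OF P_k_relators_in_carrier])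

lemma group_P_group: "group P_group"
  unfolding P_group_def by (rule group_presented_group[OF P_relators_in_carrier])

end

theory Submission
  imports Defs Complex_Main
begin

text \<open>Write \<open>m = 2\<^sup>k = 2 h\<close>, \<open>c = b\<^sup>m\<close> and \<open>d = a\<^sup>2\<close>. The relators say that \<open>a\<close> inverts \<open>c\<close> and \<open>b\<close>
  inverts \<open>d\<close>; since \<open>d\<close> is the square of \<open>a\<close>, it commutes with \<open>c\<close>. So \<open>c\<close> and \<open>d\<close> generate an abelian
  normal subgroup \<open>N\<close>, whose quotient is the free product of a cyclic group of order \<open>2\<close> and one of
  order \<open>m\<close>. All knowledge about \<open>P\<^sub>k\<close> comes from three homomorphisms:
  \<open>\<alpha>\<close> and \<open>\<beta>\<close> are affine actions on the integers in which \<open>c\<close>, respectively \<open>d\<close>, is a non-trivial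
  translation (so \<open>N\<close> is free of rank two), and \<open>\<phi>\<close> maps into the unimodular real matrices and sees the
  free product: \<open>N\<close> is the preimage of the two scalar matrices. The last claim is a positivity
  argument. The matrix of \<open>a b\<^sup>i\<close> with \<open>0 < i < m\<close> has non-negative entries and a positive diagonal, and
  it is either not diagonal or has a dominant first entry. These properties persist in products, so no
  non-empty product of such matrices is scalar.

  Torsion-freeness. Cyclic reduction conjugates every element to \<open>n b\<^sup>i\<close>, \<open>n a\<close>, or \<open>n\<close> times a non-empty
  product of factors \<open>a b\<^sup>i\<close> with \<open>0 < i < m\<close>, where \<open>n \<in> N\<close> (\<open>conjugate_cyclic_form\<close>). In the first two
  cases \<open>\<alpha>\<close> and \<open>\<beta>\<close> detect infinite order, in the third case \<open>\<phi>\<close> does.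

  Unique products. With \<open>U\<close> the integers in \<open>[-h, h]\<close> and \<open>U'\<close> those in \<open>(-h, h]\<close>, the set consisting of
  \<open>c\<close>, \<open>c\<^sup>-\<^sup>1\<close>, the elements \<open>b\<^sup>i a b\<^sup>j\<close> with \<open>i \<in> U\<close>, \<open>j \<in> U'\<close> and the elements \<open>b\<^sup>i a\<^sup>-\<^sup>1 b\<^sup>j\<close> with \<open>i \<in> U'\<close>,
  \<open>j \<in> U\<close> has a square without uniquely represented elements; for \<open>k = 1\<close> it has 14 elements.
  Products involving \<open>c\<^sup>\<plusminus>\<^sup>1\<close> and one other element \<open>v\<close> are harmless because \<open>c v = v c\<^sup>-\<^sup>1\<close>. In
  \<open>b\<^sup>i a\<^sup>\<plusminus>\<^sup>1 b\<^sup>j b\<^sup>k a\<^sup>\<plusminus>\<^sup>1 b\<^sup>l\<close> only \<open>j + k\<close> matters, so \<open>j\<close> and \<open>k\<close> can be traded against each other except at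
  the extreme values of \<open>j + k\<close>; there \<open>j + k\<close> is either \<open>\<plusminus>m\<close>, and the product collapses to \<open>b\<^bsup>i + l \<minusplus> m\<^esup>\<close>
  times a power of \<open>d\<close>, or such that the relations between \<open>b\<close> and \<open>d\<close> allow the signs at the
  two letters \<open>a\<close> to be changed (\<open>nup_set_bab_bab\<close>).

  Absence of \<open>P\<close>. Let \<open>x\<close> and \<open>y\<close> in \<open>P\<^sub>k\<close> satisfy the relations of \<open>P\<close>, and put \<open>z = x y\<close>. Then each of \<open>x\<close>,
  \<open>y\<close>, \<open>z\<close> inverts the squares of the other two. A unimodular matrix that inverts some \<open>M\<close> with
  non-scalar square is traceless and therefore has a scalar square. So if the fourth power of one
  of \<open>x\<close>, \<open>y\<close>, \<open>z\<close> lies outside \<open>N\<close>, then the squares of the other two lie in \<open>N\<close>. For \<open>k > 1\<close> this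
  forces those two elements to commute with \<open>d\<close>, which is incompatible with each inverting the square of
  the other. If all three fourth powers lie in \<open>N\<close>, they are eigenvectors for three different pairs of
  signs of \<open>(x, y)\<close>, but only the two coordinates of \<open>N\<close> are available to carry such pairs
  (\<open>no_mutually_inverting_squares\<close>).\<close>

section \<open>Homomorphisms out of presented groups\<close>

definition word_value :: "('h, 'm) monoid_scheme \<Rightarrow> ('g \<Rightarrow> 'h) \<Rightarrow> 'g word \<Rightarrow> 'h" where
  "word_value H f w =
     foldr (\<lambda>(g, e) x. (if e then f g else inv\<^bsub>H\<^esub> (f g)) \<otimes>\<^bsub>H\<^esub> x) w \<one>\<^bsub>H\<^esub>"

context group
begin

lemma word_value_closed [simp]:
  assumes "\<And>g. f g \<in> carrier G"
  shows "word_value G f w \<in> carrier G"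
  by (induction w) (auto simp: word_value_def assms)

lemma word_value_append:
  assumes "\<And>g. f g \<in> carrier G"
  shows "word_value G f (u @ v) = word_value G f u \<otimes> word_value G f v"
proof (induction u)
  case (Cons x u)
  then show ?case
    using word_value_closed[of f u] word_value_closed[of f v]
    by (cases x) (auto simp: word_value_def assms m_assoc)
qed (use word_value_closed[of f v] in \<open>auto simp: word_value_def assms\<close>)

lemma word_value_cong:
  assumes "\<And>g. f g \<in> carrier G" "cancel_eq u v"
  shows "word_value G f u = word_value G f v"
  using assms(2)
proof (induction rule: cancel_eq.induct)
  case (cancel u g e v)
  have "word_value G f [(g, e), (g, \<not> e)] = \<one>"
    by (auto simp: word_value_def assms)
  then show ?case
    by (simp add: word_value_append assms del: append_Cons)
qed auto

text \<open>Evaluation of words is constant on classes because a cancelling pair of letters evaluates to the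
  identity; hence any representative, here the one picked by \<open>SOME\<close>, can be used to define the
  homomorphism.\<close>

lemma free_group_lift:
  assumes f: "\<And>g. f g \<in> carrier G"
  obtains h where "h \<in> hom free_group G" "\<And>g. h (free_gen g) = f g"
proof -
  define h where "h A = word_value G f (SOME u. u \<in> A)" for A
  have h: "h (cancel_rel `` {u}) = word_value G f u" for u
  proof -
    have "u \<in> cancel_rel `` {u}" by (simp add: cancel_rel_def cancel_eq.refl)
    then have "(SOME v. v \<in> cancel_rel `` {u}) \<in> cancel_rel `` {u}" by (rule someI)
    then show ?thesis
      unfolding h_def by (auto simp: cancel_rel_def intro: word_value_cong[OF f, symmetric])
  qed
  show thesis
  proof
    show "h \<in> hom free_group G"
      by (rule homI) (auto elim!: free_group_carrierE
          simp: free_group_mult h word_value_append f)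
    show "h (free_gen g) = f g" for g
      by (simp add: free_gen_def h f word_value_def)
  qed
qed

end

definition pres_gen :: "'g word set set \<Rightarrow> 'g \<Rightarrow> 'g word set set" where
  "pres_gen R g = normal_closure free_group R #>\<^bsub>free_group\<^esub> free_gen g"

context
  fixes R :: "'g word set set"
  assumes R: "R \<subseteq> carrier free_group"
begin

interpretation F: group "free_group :: 'g word set monoid" by (rule group_free_group)

interpretation N: normal "normal_closure free_group R" free_group
  by (rule F.normal_closure_normal[OF R])

lemma presented_group_proj_hom:
  "(\<lambda>x. normal_closure free_group R #>\<^bsub>free_group\<^esub> x) \<in> hom free_group (presented_group R)"
  unfolding presented_group_def by (rule N.r_coset_hom_Mod)

text \<open>A relator is its own conjugate by the identity, hence an element of the normal closure.\<close>

lemma presented_group_relator: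
  assumes "r \<in> R"
  shows "normal_closure free_group R #>\<^bsub>free_group\<^esub> r = \<one>\<^bsub>presented_group R\<^esub>"
proof -
  have "r = \<one>\<^bsub>free_group\<^esub> \<otimes>\<^bsub>free_group\<^esub> r \<otimes>\<^bsub>free_group\<^esub> inv\<^bsub>free_group\<^esub> \<one>\<^bsub>free_group\<^esub>"
    using assms R by auto
  then have "r \<in> normal_closure free_group R"
    unfolding normal_closure_def using assms by (intro generate.incl) blast
  then show ?thesis
    using assms R by (simp add: presented_group_def F.coset_join2 N.subgroup_axioms subset_iff)
qed

text \<open>The universal property: the kernel of \<open>h\<close> is normal and contains the relators, so it contains the
  normal closure and \<open>h\<close> factors through the quotient.\<close>

lemma presented_group_lift:
  assumes "group H" and h: "h \<in> hom free_group H" and rel: "\<And>r. r \<in> R \<Longrightarrow> h r = \<one>\<^bsub>H\<^esub>"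
  obtains \<phi> where "\<phi> \<in> hom (presented_group R) H" "\<And>g. \<phi> (pres_gen R g) = h (free_gen g)"
proof -
  interpret h: group_hom free_group H h
    by (intro group_hom.intro group_hom_axioms.intro assms F.is_group)
  have "normal_closure free_group R \<subseteq> kernel free_group H h"
    unfolding normal_closure_def
  proof (rule F.generate_subgroup_incl[OF _ h.subgroup_kernel])
    show "{g \<otimes>\<^bsub>free_group\<^esub> r \<otimes>\<^bsub>free_group\<^esub> inv\<^bsub>free_group\<^esub> g |g r. g \<in> carrier free_group \<and> r \<in> R}
      \<subseteq> kernel free_group H h"
      using R rel by (auto simp: kernel_def subset_iff)
  qed
  then obtain \<phi> where "\<phi> \<in> hom (free_group Mod normal_closure free_group R) H"
    "\<And>x. x \<in> carrier free_group \<Longrightarrow> \<phi> (normal_closure free_group R #>\<^bsub>free_group\<^esub> x) = h x"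
    using h.FactGroup_universal_kernel[OF N.normal_axioms] by metis
  with that show thesis
    by (simp add: presented_group_def pres_gen_def free_gen_in_carrier)
qed

lemma pres_gen_in_carrier: "pres_gen R g \<in> carrier (presented_group R)"
  using presented_group_proj_hom by (auto simp: pres_gen_def hom_def free_gen_in_carrier)

text \<open>Every element is the image of a word, and the induction is over that word.\<close>

lemma presented_group_induct:
  assumes x: "x \<in> carrier (presented_group R)"
    and one: "P \<one>\<^bsub>presented_group R\<^esub>"
    and gen: "\<And>g x. x \<in> carrier (presented_group R) \<Longrightarrow> P x \<Longrightarrow>
        P (pres_gen R g \<otimes>\<^bsub>presented_group R\<^esub> x)"
    and gen_inv: "\<And>g x. x \<in> carrier (presented_group R) \<Longrightarrow> P x \<Longrightarrow>
        P (inv\<^bsub>presented_group R\<^esub> pres_gen R g \<otimes>\<^bsub>presented_group R\<^esub> x)"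
  shows "P x"
proof -
  define \<pi> where "\<pi> = (\<lambda>x. normal_closure free_group R #>\<^bsub>free_group\<^esub> x)"
  interpret \<pi>: group_hom free_group "presented_group R" \<pi>
    unfolding \<pi>_def
    by (intro group_hom.intro group_hom_axioms.intro presented_group_proj_hom F.is_group
        group_presented_group[OF R])
  define cls where "cls u = cancel_rel `` {u}" for u :: "'g word"
  have cls: "cls u \<in> carrier free_group" for u
    by (simp add: cls_def free_group_class_in_carrier)
  have "P (\<pi> (cls u))" for u
  proof (induction u)
    case Nil
    have "\<pi> (cls []) = \<one>\<^bsub>presented_group R\<^esub>"
      unfolding cls_def by (metis \<pi>.hom_one free_group_one)
    then show ?case using one by simp
  next
    case (Cons y u)
    obtain g e where y: "y = (g, e)" by (cases y)
    have app: "cls (v @ w) = cls v \<otimes>\<^bsub>free_group\<^esub> cls w" for v w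
      by (simp add: cls_def free_group_mult)
    have pos: "cls [(g, True)] = free_gen g"
      by (simp add: cls_def free_gen_def)
    have "cls [(g, False)] \<otimes>\<^bsub>free_group\<^esub> cls [(g, True)] = \<one>\<^bsub>free_group\<^esub>"
      unfolding app[symmetric] unfolding cls_def free_group_one
      using cancel_eq.cancel[of "[]" g False "[]"]
      by (intro equiv_class_eq[OF equiv_cancel_rel]) (simp add: cancel_rel_def)
    then have neg: "cls [(g, False)] = inv\<^bsub>free_group\<^esub> free_gen g"
      using cls by (simp add: F.inv_equality pos[symmetric])
    have "\<pi> (cls (y # u)) = \<pi> (cls [y]) \<otimes>\<^bsub>presented_group R\<^esub> \<pi> (cls u)"
      using app[of "[y]" u] cls by simp
    moreover have "\<pi> (cls [y]) = (if e then pres_gen R g else inv\<^bsub>presented_group R\<^esub> pres_gen R g)"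
      using pos neg by (auto simp: y pres_gen_def \<pi>_def[symmetric] free_gen_in_carrier)
    ultimately show ?case
      using gen gen_inv Cons cls by (cases e) auto
  qed
  moreover obtain u where "x = \<pi> (cls u)"
    using x by (auto simp: presented_group_def carrier_FactGroup \<pi>_def cls_def
        elim!: free_group_carrierE)
  ultimately show ?thesis by simp
qed

end


section \<open>Elements that invert each other's powers\<close>

context group
begin

lemma conj_int_pow:
  assumes "x \<in> carrier G" "y \<in> carrier G"
  shows "x \<otimes> y [^] (r::int) \<otimes> inv x = (x \<otimes> y \<otimes> inv x) [^] r"
proof -
  have "(\<lambda>u. x \<otimes> u \<otimes> inv x) \<in> hom G G"
  proof (rule homI)
    show "x \<otimes> (u \<otimes> v) \<otimes> inv x = x \<otimes> u \<otimes> inv x \<otimes> (x \<otimes> v \<otimes> inv x)"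
      if "u \<in> carrier G" "v \<in> carrier G" for u v
    proof -
      have "x \<otimes> u \<otimes> inv x \<otimes> (x \<otimes> v \<otimes> inv x) = x \<otimes> u \<otimes> (inv x \<otimes> x) \<otimes> v \<otimes> inv x"
        using assms that by (simp only: m_assoc m_closed inv_closed)
      then show ?thesis using assms that by (simp add: m_assoc)
    qed
  qed (use assms in auto)
  from hom_int_pow[OF this assms(2) is_group is_group] show ?thesis .
qed

text \<open>Passing one letter \<open>x\<close> across a power of \<open>y\<close> changes the sign of the exponent, so only the parity of
  the number of letters matters.\<close>

lemma inverting_int_pow:
  assumes x: "x \<in> carrier G" and y: "y \<in> carrier G" and inverts: "x \<otimes> y \<otimes> inv x = inv y"
  shows "x [^] (i::int) \<otimes> y [^] (r::int) = y [^] (if even i then r else - r) \<otimes> x [^] i"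
proof -
  have step: "x \<otimes> y [^] r = y [^] (- r) \<otimes> x" for r :: int
    using conj_int_pow[OF x y, of r] inverts x y
    by (simp add: int_pow_inv int_pow_neg inv_solve_right')
  show ?thesis
  proof (induction i arbitrary: r rule: int_induct[where k = 0])
    case base
    then show ?case using x y by simp
  next
    case (step1 i)
    have "x [^] (i + 1) \<otimes> y [^] r = x [^] i \<otimes> y [^] (- r) \<otimes> x"
      using x y by (simp add: int_pow_mult step m_assoc)
    also have "\<dots> = y [^] (if even i then - r else r) \<otimes> x [^] (i + 1)"
      using x y by (simp add: step1 int_pow_mult m_assoc)
    finally show ?case by simp
  next
    case (step2 i)
    have "x [^] (i - 1) \<otimes> y [^] r \<otimes> x = x [^] (i - 1) \<otimes> x \<otimes> y [^] (- r)"
      using x y step[of "- r"] by (simp add: m_assoc)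
    also have "x [^] (i - 1) \<otimes> x = x [^] i"
      using x int_pow_mult[of x "i - 1" 1] by simp
    also have "x [^] i \<otimes> y [^] (- r) = y [^] (if even i then - r else r) \<otimes> x [^] i"
      by (simp add: step2)
    also have "x [^] i = x [^] (i - 1) \<otimes> x"
      using x int_pow_mult[of x "i - 1" 1] by simp
    finally have "x [^] (i - 1) \<otimes> y [^] r = y [^] (if even i then - r else r) \<otimes> x [^] (i - 1)"
      using x y by (simp add: m_assoc[symmetric])
    then show ?case by (simp split: if_splits)
  qed
qed

end

text \<open>The relations of \<open>P\<^sub>k\<close> with \<open>h\<close> in the place of \<open>2\<^bsup>k - 1\<^esup>\<close>. The half period \<open>h\<close> is the parameter because
  it bounds the exponents in the set without unique products.\<close>

locale mutually_inverting = group G for G (structure) +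
  fixes a b :: 'a and h :: int
  assumes a [simp]: "a \<in> carrier G" and b [simp]: "b \<in> carrier G" and h: "h > 0"
    and a_inverts: "a \<otimes> b [^] (2 * h) \<otimes> inv a = inv (b [^] (2 * h))"
    and b_inverts: "b \<otimes> a [^] (2::int) \<otimes> inv b = inv (a [^] (2::int))"
begin

lemma b_add: "b [^] (i::int) \<otimes> b [^] (j::int) = b [^] (i + j)"
  by (simp add: int_pow_mult)

lemma b_add_left: "x \<in> carrier G \<Longrightarrow> b [^] (i::int) \<otimes> (b [^] (j::int) \<otimes> x) = b [^] (i + j) \<otimes> x"
  by (simp add: b_add m_assoc[symmetric])

lemma a_add: "a [^] (i::int) \<otimes> a [^] (j::int) = a [^] (i + j)"
  by (simp add: int_pow_mult)

lemma a_add_left: "x \<in> carrier G \<Longrightarrow> a [^] (i::int) \<otimes> (a [^] (j::int) \<otimes> x) = a [^] (i + j) \<otimes> x"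
  by (simp add: a_add m_assoc[symmetric])

lemma a_past_c:
  "a [^] (i::int) \<otimes> b [^] (2 * h * r) = b [^] (2 * h * (if even i then r else - r)) \<otimes> a [^] i"
  using inverting_int_pow[OF _ _ a_inverts, of i r] by (simp add: int_pow_pow)

lemma b_past_d:
  "b [^] (i::int) \<otimes> a [^] (2 * r :: int) = a [^] (2 * (if even i then r else - r)) \<otimes> b [^] i"
  using inverting_int_pow[OF _ _ b_inverts, of i r] by (simp add: int_pow_pow)

definition bab :: "int \<Rightarrow> int \<Rightarrow> int \<Rightarrow> 'a" where
  "bab e i j = b [^] i \<otimes> a [^] e \<otimes> b [^] j"

definition babab :: "int \<Rightarrow> int \<Rightarrow> int \<Rightarrow> int \<Rightarrow> int \<Rightarrow> 'a" where
  "babab e f i n l = b [^] i \<otimes> a [^] e \<otimes> b [^] n \<otimes> a [^] f \<otimes> b [^] l"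

lemma bab_closed [simp]: "bab e i j \<in> carrier G"
  by (simp add: bab_def)

lemma bab_mult: "bab e i j \<otimes> bab f k l = babab e f i (j + k) l"
  by (simp add: bab_def babab_def m_assoc b_add_left)

text \<open>Because \<open>a\<close> inverts \<open>b\<^bsup>2 h\<^esup>\<close>, inserting that power on both sides of an odd power of \<open>a\<close> has no effect.\<close>

lemma babab_shift_left:
  assumes "odd e"
  shows "babab e f (i + 2 * h * r) (n + 2 * h * r) l = babab e f i n l"
proof -
  have "b [^] (i + 2 * h * r) \<otimes> a [^] e \<otimes> b [^] (n + 2 * h * r) =
      b [^] i \<otimes> b [^] (2 * h * r) \<otimes> (a [^] e \<otimes> b [^] (2 * h * r)) \<otimes> b [^] n"
    by (simp add: m_assoc b_add_left b_add add.commute)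
  also have "\<dots> = b [^] i \<otimes> a [^] e \<otimes> b [^] n"
    using assms a_past_c[of e r] by (simp add: m_assoc b_add_left)
  finally show ?thesis by (simp add: babab_def)
qed

lemma babab_shift_right:
  assumes "odd f"
  shows "babab e f i (n + 2 * h * r) (l + 2 * h * r) = babab e f i n l"
proof -
  have "b [^] (n + 2 * h * r) \<otimes> a [^] f \<otimes> b [^] (l + 2 * h * r) =
      b [^] n \<otimes> b [^] (2 * h * r) \<otimes> (a [^] f \<otimes> b [^] (2 * h * r)) \<otimes> b [^] l"
    by (simp add: m_assoc b_add_left b_add add.commute)
  also have "\<dots> = b [^] n \<otimes> a [^] f \<otimes> b [^] l"
    using assms a_past_c[of f r] by (simp add: m_assoc b_add_left)
  finally show ?thesis by (simp add: babab_def m_assoc)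
qed

text \<open>Moving \<open>d = a\<^sup>2\<close> from the second letter \<open>a\<close> to the first across \<open>b\<^sup>n\<close> inverts it precisely if \<open>n\<close> is
  odd. Hence equal signs can be flipped simultaneously for odd \<open>n\<close>, and opposite signs can be exchanged for
  even \<open>n\<close>.\<close>

lemma babab_flip_odd:
  assumes "odd n"
  shows "babab (-1) (-1) i n l = babab 1 1 i n l"
proof -
  have "b [^] n \<otimes> a [^] (-1::int) = b [^] n \<otimes> a [^] (-2::int) \<otimes> a [^] (1::int)"
    by (simp add: m_assoc a_add del: int_pow_1)
  also have "b [^] n \<otimes> a [^] (-2::int) = a [^] (2::int) \<otimes> b [^] n"
    using assms b_past_d[of n "-1"] by simp
  finally have "a [^] (-1::int) \<otimes> (b [^] n \<otimes> a [^] (-1::int)) =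
      a [^] (1::int) \<otimes> (b [^] n \<otimes> a [^] (1::int))"
    by (simp add: m_assoc a_add_left del: int_pow_1)
  then show ?thesis by (simp add: babab_def m_assoc)
qed

lemma babab_flip_even:
  assumes "even n"
  shows "babab 1 (-1) i n l = babab (-1) 1 i n l"
proof -
  have "b [^] n \<otimes> a [^] (-1::int) = b [^] n \<otimes> a [^] (-2::int) \<otimes> a [^] (1::int)"
    by (simp add: m_assoc a_add del: int_pow_1)
  also have "b [^] n \<otimes> a [^] (-2::int) = a [^] (-2::int) \<otimes> b [^] n"
    using assms b_past_d[of n "-1"] by simp
  finally have "a [^] (1::int) \<otimes> (b [^] n \<otimes> a [^] (-1::int)) =
      a [^] (-1::int) \<otimes> (b [^] n \<otimes> a [^] (1::int))"
    by (simp add: m_assoc a_add_left del: int_pow_1)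
  then show ?thesis by (simp add: babab_def m_assoc)
qed

text \<open>When the inner power of \<open>b\<close> is a multiple of the full period, it can be moved to the left of the
  first letter \<open>a\<close>; the two powers of \<open>a\<close> then meet and the product becomes shorter.\<close>

lemma babab_collapse_opposite:
  assumes "odd e"
  shows "babab e (- e) i (2 * h * r) l = b [^] (i + l - 2 * h * r)"
proof -
  have "babab e (- e) i (2 * h * r) l = babab e (- e) (i - 2 * h * r) 0 l"
    using babab_shift_left[OF assms, of "- e" "i - 2 * h * r" r 0 l] by simp
  also have "\<dots> = b [^] (i + l - 2 * h * r)"
    by (simp add: babab_def m_assoc a_add_left b_add algebra_simps)
  finally show ?thesis .
qed

lemma babab_collapse_equal:
  assumes "odd e"
  shows "babab e e i (2 * h * r) l =
    b [^] (i + l - 2 * h * r) \<otimes> a [^] (2 * (if even l then e else - e))"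
proof -
  have "babab e e i (2 * h * r) l = babab e e (i - 2 * h * r) 0 l"
    using babab_shift_left[OF assms, of e "i - 2 * h * r" r 0 l] by simp
  also have "\<dots> = b [^] (i - 2 * h * r) \<otimes> (a [^] (2 * e) \<otimes> b [^] l)"
    by (simp add: babab_def m_assoc a_add_left)
  also have "a [^] (2 * e) \<otimes> b [^] l = b [^] l \<otimes> a [^] (2 * (if even l then e else - e))"
    by (simp add: b_past_d)
  finally show ?thesis
    by (simp add: m_assoc b_add_left algebra_simps)
qed

lemma c_bab:
  assumes "odd e"
  shows "b [^] (2 * h * r) \<otimes> bab e i j = bab e i j \<otimes> b [^] (2 * h * (- r))"
proof -
  have "bab e i j \<otimes> b [^] (2 * h * (- r)) = b [^] i \<otimes> (a [^] e \<otimes> b [^] (2 * h * (- r))) \<otimes> b [^] j"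
    by (simp add: bab_def m_assoc b_add add.commute)
  also have "\<dots> = b [^] (2 * h * r) \<otimes> bab e i j"
    using assms a_past_c[of e "- r"] by (simp add: bab_def m_assoc b_add_left add.commute)
  finally show ?thesis ..
qed

end

section \<open>Two affine actions on the integers\<close>

text \<open>The pair \<open>(e, t)\<close> stands for the affine map \<open>n \<mapsto> e n + t\<close> of the integers.\<close>

definition Aff :: "(int \<times> int) monoid" where
  "Aff = \<lparr>carrier = {1, -1} \<times> UNIV,
     monoid.mult = (\<lambda>(e, s) (f, t). (e * f, s + e * t)), monoid.one = (1, 0)\<rparr>"

lemma group_Aff: "group Aff"
proof (rule groupI)
  show "\<exists>y\<in>carrier Aff. y \<otimes>\<^bsub>Aff\<^esub> x = \<one>\<^bsub>Aff\<^esub>" if "x \<in> carrier Aff" for x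
    using that by (intro bexI[of _ "(fst x, - fst x * snd x)"]) (auto simp: Aff_def)
qed (auto simp: Aff_def algebra_simps)

lemma Aff_mult [simp]: "(e, s) \<otimes>\<^bsub>Aff\<^esub> (f, t) = (e * f, s + e * t)"
  by (simp add: Aff_def)

lemma Aff_one: "\<one>\<^bsub>Aff\<^esub> = (1, 0)"
  by (simp add: Aff_def)

lemma Aff_carrier [simp]: "(e, t) \<in> carrier Aff \<longleftrightarrow> e = 1 \<or> e = -1"
  by (auto simp: Aff_def)

lemma Aff_translation_nat_pow: "(1, t) [^]\<^bsub>Aff\<^esub> (n::nat) = (1, int n * t)"
  by (induction n) (auto simp: nat_pow_def Aff_one algebra_simps)

lemma Aff_translation_int_pow: "(1, t) [^]\<^bsub>Aff\<^esub> (n::int) = (1, n * t)"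
proof (cases "n < 0")
  case True
  have "inv\<^bsub>Aff\<^esub> (1, - n * t) = (1, n * t)"
    by (rule group.inv_equality[OF group_Aff]) (auto simp: Aff_one)
  with True show ?thesis by (simp add: int_pow_def2 Aff_translation_nat_pow)
qed (simp add: int_pow_def2 Aff_translation_nat_pow)

lemma Aff_reflection_int_pow: "(-1, 0) [^]\<^bsub>Aff\<^esub> (n::int) = (if even n then 1 else -1, 0)"
proof -
  have *: "(-1, 0) [^]\<^bsub>Aff\<^esub> (n::nat) = (if even n then 1 else -1, 0)" for n
    by (induction n) (auto simp: nat_pow_def Aff_one)
  have "inv\<^bsub>Aff\<^esub> (-1, 0) = (-1, 0)" "inv\<^bsub>Aff\<^esub> (1, 0) = (1, 0)"
    by (rule group.inv_equality[OF group_Aff]; simp add: Aff_one)+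
  then show ?thesis
    by (auto simp: int_pow_def2 * even_nat_iff)
qed

text \<open>In \<open>\<alpha>\<close> the element \<open>b\<close> is a translation that \<open>a\<close> reflects, in \<open>\<beta>\<close> the roles are exchanged. The
  actions serve to prove that elements are different and, by their linear parts, to read off how
  an element acts on the translation lattice.\<close>

locale acting_on_lines = mutually_inverting +
  fixes \<alpha> \<beta> :: "'a \<Rightarrow> int \<times> int"
  assumes \<alpha>_hom: "\<alpha> \<in> hom G Aff" and \<alpha>_a: "\<alpha> a = (-1, 0)" and \<alpha>_b: "\<alpha> b = (1, 1)"
    and \<beta>_hom: "\<beta> \<in> hom G Aff" and \<beta>_a: "\<beta> a = (1, 1)" and \<beta>_b: "\<beta> b = (-1, 0)"
begin

sublocale \<alpha>: group_hom G Aff \<alpha>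
  by (intro group_hom.intro group_hom_axioms.intro group_Aff is_group \<alpha>_hom)

sublocale \<beta>: group_hom G Aff \<beta>
  by (intro group_hom.intro group_hom_axioms.intro group_Aff is_group \<beta>_hom)

lemma \<alpha>_pow [simp]: "\<alpha> (a [^] (n::int)) = (if even n then 1 else -1, 0)" "\<alpha> (b [^] (n::int)) = (1, n)"
  by (simp_all add: \<alpha>.hom_int_pow \<alpha>_a \<alpha>_b Aff_reflection_int_pow Aff_translation_int_pow)

lemma \<beta>_pow [simp]: "\<beta> (a [^] (n::int)) = (1, n)" "\<beta> (b [^] (n::int)) = (if even n then 1 else -1, 0)"
  by (simp_all add: \<beta>.hom_int_pow \<beta>_a \<beta>_b Aff_reflection_int_pow Aff_translation_int_pow)

text \<open>\<open>\<alpha>\<close> recovers \<open>i - j\<close>, and the translation part of \<open>\<beta>\<close> is \<open>e\<close> up to a sign depending on \<open>i\<close>.\<close>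

lemma bab_distinct:
  assumes "odd e" "odd f" "i - j \<noteq> k - l \<or> i = k \<and> e \<noteq> f"
  shows "bab e i j \<noteq> bab f k l"
proof
  assume eq: "bab e i j = bab f k l"
  have "\<alpha> (bab e i j) = (-1, i - j)" "\<alpha> (bab f k l) = (-1, k - l)"
    using assms by (simp_all add: bab_def)
  moreover have "snd (\<beta> (bab e i j)) = (if even i then e else - e)"
    "snd (\<beta> (bab f k l)) = (if even k then f else - f)"
    using assms by (simp_all add: bab_def)
  ultimately show False
    using eq assms by (auto split: if_splits)
qed

text \<open>\<open>\<alpha>\<close> maps the left-hand side to a translation and the right-hand side to a reflection.\<close>

lemma bab_neq_b:
  assumes "odd e"
  shows "b [^] (n::int) \<noteq> bab e i j"
proof
  assume "b [^] n = bab e i j"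
  then have "fst (\<alpha> (b [^] n)) = fst (\<alpha> (bab e i j))" by simp
  then show False using assms by (simp add: bab_def)
qed

section \<open>A finite set without unique products\<close>

text \<open>The two half-open squares of exponents are exchanged by reversing words and inverting \<open>a\<close>, which is
  an anti-automorphism. The missing sides are chosen so that the extreme products, which cannot be
  altered by trading \<open>j\<close> against \<open>k\<close>, coincide with products of another kind.\<close>

definition in_strip :: "int \<Rightarrow> int \<Rightarrow> int \<Rightarrow> bool" where
  "in_strip e i j \<longleftrightarrow>
     e = 1 \<and> - h \<le> i \<and> i \<le> h \<and> - h < j \<and> j \<le> h \<or>
     e = -1 \<and> - h < i \<and> i \<le> h \<and> - h \<le> j \<and> j \<le> h"

definition nup_set :: "'a set" where
  "nup_set = {b [^] (2 * h), b [^] (- (2 * h))} \<union> {bab e i j |e i j. in_strip e i j}"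

lemma finite_nup_set: "finite nup_set"
proof -
  have "{bab e i j |e i j. in_strip e i j} \<subseteq>
      (\<lambda>(e, i, j). bab e i j) ` ({1, -1} \<times> {- h..h} \<times> {- h..h})"
    by (force simp: in_strip_def)
  then have "finite {bab e i j |e i j. in_strip e i j}"
    by (rule finite_subset) simp
  then show ?thesis by (simp add: nup_set_def)
qed

text \<open>In the names of the cases, the letters p and m give the signs of the two exponents of \<open>a\<close>, and top
  or bottom says whether \<open>j + k\<close> is as large or as small as possible.\<close>

lemma nup_set_bab_bab:
  assumes x: "in_strip e i j" and y: "in_strip f k l"
  shows "\<exists>x'\<in>nup_set. \<exists>y'\<in>nup_set. x' \<noteq> bab e i j \<and> x' \<otimes> y' = bab e i j \<otimes> bab f k l"
proof -
  have odd: "odd e" "odd f"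
    using x y by (auto simp: in_strip_def)
  have alt: ?thesis
    if "in_strip e' i' j'" "in_strip f' k' l'"
      "i' - j' \<noteq> i - j \<or> i' = i \<and> e' \<noteq> e"
      "j' + k' = n'" "j + k = n" "babab e' f' i' n' l' = babab e f i n l" for e' f' i' j' k' l' n n'
  proof -
    have "odd e'"
      using that by (auto simp: in_strip_def)
    with that odd show ?thesis
      by (intro bexI[of _ "bab e' i' j'"] bexI[of _ "bab f' k' l'"] conjI bab_distinct)
        (auto simp: nup_set_def bab_mult)
  qed
  have b_alt: ?thesis
    if "r \<in> {2 * h, - (2 * h)}" "s \<in> {2 * h, - (2 * h)}" "babab e f i (j + k) l = b [^] (r + s)" for r s
    using that odd
    by (intro bexI[of _ "b [^] r"] bexI[of _ "b [^] s"] conjI bab_neq_b)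
      (auto simp: nup_set_def bab_mult b_add)
  (* Only the sum of j and k matters, so one of them can be increased at the expense of the other
     unless this leaves the strip in both directions. *)
  consider (slide_up) "in_strip e i (j + 1)" "in_strip f (k - 1) l"
    | (slide_down) "in_strip e i (j - 1)" "in_strip f (k + 1) l"
    | (pp_top) "e = 1" "f = 1" "j = h" "k = h"
    | (pp_bottom) "e = 1" "f = 1" "j = 1 - h" "k = - h"
    | (pm_top) "e = 1" "f = -1" "j = h" "k = h"
    | (pm_bottom) "e = 1" "f = -1" "j = 1 - h" "k = 1 - h"
    | (mp_top) "e = -1" "f = 1" "j = h" "k = h"
    | (mp_bottom) "e = -1" "f = 1" "j = - h" "k = - h"
    | (mm_top) "e = -1" "f = -1" "j = h" "k = h"
    | (mm_bottom) "e = -1" "f = -1" "j = - h" "k = 1 - h"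
    using x y h unfolding in_strip_def by (smt (verit))
  then show ?thesis
  proof cases
    case slide_up
    then show ?thesis by (intro alt[of e i "j + 1" f "k - 1" l "j + k" "j + k"]) auto
  next
    case slide_down
    then show ?thesis by (intro alt[of e i "j - 1" f "k + 1" l "j + k" "j + k"]) auto
  next
    case pp_top
    (* The inner power is c. After the collapse the product depends on l only by its parity, and
       flipping both signs compensates for an odd change of l. *)
    have val: "babab 1 1 i' (2 * h) l' = b [^] (i' + l' - 2 * h) \<otimes> a [^] (2 * (if even l' then 1 else -1::int))"
      "babab (-1) (-1) i' (2 * h) l' = b [^] (i' + l' - 2 * h) \<otimes> a [^] (2 * (if even l' then -1 else 1::int))"
      "babab 1 1 i' 0 l' = b [^] (i' + l') \<otimes> a [^] (2 * (if even l' then 1 else -1::int))" for i' l'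
      using babab_collapse_equal[of 1 i' 1 l'] babab_collapse_equal[of "-1" i' 1 l']
        babab_collapse_equal[of 1 i' 0 l'] by (simp_all flip: mult_2)
    consider "i < h" | "i = h" "l < h" | "i = h" "l = h"
      using x y pp_top unfolding in_strip_def by linarith
    then show ?thesis
    proof cases
      case 1
      then show ?thesis using x y pp_top h
        by (intro alt[of "-1" "i + 1" h "-1" h "l - 1" "2 * h" "2 * h"]) (auto simp: in_strip_def val)
    next
      case 2
      then show ?thesis using x y pp_top h
        by (intro alt[of "-1" "i - 1" h "-1" h "l + 1" "2 * h" "2 * h"]) (auto simp: in_strip_def val)
    next
      case 3
      then show ?thesis using x y pp_top h
        by (intro alt[of 1 "- h" 0 1 0 h 0 "2 * h"]) (auto simp: in_strip_def val)
    qed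
  next
    case pp_bottom
    (* The inner exponent is odd, so both signs may be flipped; the exponent i = - h is not allowed
       next to the inverse of a, and there a shift by the full period leads to an inner exponent that
       can be split in another way. *)
    show ?thesis
    proof (cases "i = - h")
      case False
      then show ?thesis using x y pp_bottom h babab_flip_odd[of "1 - 2 * h" i l]
        by (intro alt[of "-1" i "- h" "-1" "1 - h" l "1 - 2 * h" "1 - 2 * h"]) (auto simp: in_strip_def)
    next
      case True
      then show ?thesis using x y pp_bottom h babab_shift_left[of 1 1 "- h" 1 "1 - 2 * h" l]
        by (intro alt[of 1 h 1 1 0 l 1 "1 - 2 * h"]) (auto simp: in_strip_def)
    qed
  next
    case pm_top
    have val: "babab 1 (-1) i' (2 * h) l' = b [^] (i' + l' - 2 * h)" for i' l'
      using babab_collapse_opposite[of 1 i' 1 l'] by (simp flip: mult_2)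
    (* The product is a power of b that depends only on i + l. Two pairs of extreme exponents have no
       neighbour with the same sum; their products are 1 and the inverse of c squared. *)
    consider "i < h" "l > - h" | "i > - h" "l < h" | "i = h" "l = h" | "i = - h" "l = - h"
      using x y pm_top unfolding in_strip_def by linarith
    then show ?thesis
    proof cases
      case 1
      then show ?thesis using x y pm_top h
        by (intro alt[of 1 "i + 1" h "-1" h "l - 1" "2 * h" "2 * h"]) (auto simp: in_strip_def val)
    next
      case 2
      then show ?thesis using x y pm_top h
        by (intro alt[of 1 "i - 1" h "-1" h "l + 1" "2 * h" "2 * h"]) (auto simp: in_strip_def val)
    next
      case 3
      then show ?thesis using pm_top
        by (intro b_alt[of "2 * h" "- (2 * h)"]) (auto simp: val)
    next
      case 4
      then show ?thesis using pm_top
        by (intro b_alt[of "- (2 * h)" "- (2 * h)"]) (auto simp: val)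
    qed
  next
    case pm_bottom
    (* The inner exponent is even, so the opposite signs may be exchanged, unless an outer exponent
       is - h; then a shift by the full period applies. *)
    consider "i \<noteq> - h" "l \<noteq> - h" | "i = - h" | "l = - h" by blast
    then show ?thesis
    proof cases
      case 1
      then show ?thesis using x y pm_bottom h babab_flip_even[of "2 - 2 * h" i l]
        by (intro alt[of "-1" i "1 - h" 1 "1 - h" l "2 - 2 * h" "2 - 2 * h"]) (auto simp: in_strip_def)
    next
      case 2
      then show ?thesis
        using x y pm_bottom h babab_shift_left[of 1 "-1" "- h" 1 "2 - 2 * h" l]
        by (intro alt[of 1 h 1 "-1" 1 l 2 "2 - 2 * h"]) (auto simp: in_strip_def)
    next
      case 3
      then show ?thesis
        using x y pm_bottom h babab_shift_right[of "-1" 1 i "2 - 2 * h" 1 "- h"]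
        by (intro alt[of 1 i 1 "-1" 1 h 2 "2 - 2 * h"]) (auto simp: in_strip_def)
    qed
  next
    case mp_top
    (* The two half-open squares are placed so that exchanging the signs is always possible here. *)
    then show ?thesis using x y h babab_flip_even[of "2 * h" i l]
      by (intro alt[of 1 i h "-1" h l "2 * h" "2 * h"]) (auto simp: in_strip_def)
  next
    case mp_bottom
    have val: "babab (-1) 1 i' (- (2 * h)) l' = b [^] (i' + l' + 2 * h)"
      "babab (-1) 1 i' 0 l' = b [^] (i' + l')" for i' l'
      using babab_collapse_opposite[of "-1" i' "-1" l'] babab_collapse_opposite[of "-1" i' 0 l']
      by simp_all
    (* Again a power of b that depends only on i + l; the exceptional sums give c squared and b squared. *)
    consider "i < h" "l > 1 - h" | "i > 1 - h" "l < h" | "i = h" "l = h" | "i = 1 - h" "l = 1 - h"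
      using x y mp_bottom unfolding in_strip_def by linarith
    then show ?thesis
    proof cases
      case 1
      then show ?thesis using x y mp_bottom h
        by (intro alt[of "-1" "i + 1" "- h" 1 "- h" "l - 1" "- (2 * h)" "- (2 * h)"]) (auto simp: in_strip_def val)
    next
      case 2
      then show ?thesis using x y mp_bottom h
        by (intro alt[of "-1" "i - 1" "- h" 1 "- h" "l + 1" "- (2 * h)" "- (2 * h)"]) (auto simp: in_strip_def val)
    next
      case 3
      then show ?thesis using mp_bottom
        by (intro b_alt[of "2 * h" "2 * h"]) (auto simp: val)
    next
      case 4
      then show ?thesis using x y mp_bottom h
        by (intro alt[of "-1" 1 1 1 "-1" 1 0 "- (2 * h)"]) (auto simp: in_strip_def val)
    qed
  next
    case mm_top
    have val: "babab 1 1 i' (2 * h) l' = b [^] (i' + l' - 2 * h) \<otimes> a [^] (2 * (if even l' then 1 else -1::int))"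
      "babab (-1) (-1) i' (2 * h) l' = b [^] (i' + l' - 2 * h) \<otimes> a [^] (2 * (if even l' then -1 else 1::int))"
      "babab (-1) (-1) i' 0 l' = b [^] (i' + l') \<otimes> a [^] (2 * (if even l' then -1 else 1::int))" for i' l'
      using babab_collapse_equal[of 1 i' 1 l'] babab_collapse_equal[of "-1" i' 1 l']
        babab_collapse_equal[of "-1" i' 0 l'] by (simp_all flip: mult_2)
    consider "l < h" | "l = h" "i < h" | "i = h" "l = h"
      using x y mm_top unfolding in_strip_def by linarith
    then show ?thesis
    proof cases
      case 1
      then show ?thesis using x y mm_top h
        by (intro alt[of 1 "i - 1" h 1 h "l + 1" "2 * h" "2 * h"]) (auto simp: in_strip_def val)
    next
      case 2
      then show ?thesis using x y mm_top h
        by (intro alt[of 1 "i + 1" h 1 h "l - 1" "2 * h" "2 * h"]) (auto simp: in_strip_def val)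
    next
      case 3
      then show ?thesis using x y mm_top h
        by (intro alt[of "-1" h 0 "-1" 0 "- h" 0 "2 * h"]) (auto simp: in_strip_def val)
    qed
  next
    case mm_bottom
    show ?thesis
    proof (cases "l = - h")
      case False
      then show ?thesis using x y mm_bottom h babab_flip_odd[of "1 - 2 * h" i l]
        by (intro alt[of 1 i "1 - h" 1 "- h" l "1 - 2 * h" "1 - 2 * h"]) (auto simp: in_strip_def)
    next
      case True
      then show ?thesis using x y mm_bottom h babab_shift_right[of "-1" "-1" i "1 - 2 * h" 1 "- h"]
        by (intro alt[of "-1" i 0 "-1" 1 h 1 "1 - 2 * h"]) (auto simp: in_strip_def)
    qed
  qed
qed

text \<open>The squares of \<open>c\<close> and of its inverse are represented a second time by products of two strip elements
  at the corners of the strips; all other products with \<open>c\<close> or its inverse as a factor are represented a second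
  time by exchanging the factors, which inverts \<open>c\<close> when it passes a strip element.\<close>

lemma nup_set_no_unique_product:
  assumes "x \<in> nup_set" "y \<in> nup_set"
  shows "\<exists>x'\<in>nup_set. \<exists>y'\<in>nup_set. (x', y') \<noteq> (x, y) \<and> x' \<otimes> y' = x \<otimes> y"
proof -
  have corner: "\<exists>x'\<in>nup_set. \<exists>y'\<in>nup_set. (x', y') \<noteq> (b [^] r, b [^] s) \<and> x' \<otimes> y' = b [^] r \<otimes> b [^] s"
    if rs: "r \<in> {2 * h, - (2 * h)}" "s \<in> {2 * h, - (2 * h)}" for r s
  proof -
    have "r \<noteq> 0" using rs h by auto
    consider "r = 2 * h" "s = 2 * h" | "r = - (2 * h)" "s = - (2 * h)" | "s = - r"
      using rs by fastforce
    then show ?thesis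
    proof cases
      case 1
      have "bab (-1) h (- h) \<otimes> bab 1 (- h) h = b [^] r \<otimes> b [^] s"
        using babab_collapse_opposite[of "-1" h "-1" h] 1 by (simp add: bab_mult b_add)
      moreover have "in_strip (-1) h (- h)" "in_strip 1 (- h) h"
        using h by (auto simp: in_strip_def)
      ultimately show ?thesis
        using bab_neq_b[of "-1" r h "- h"]
        by (intro bexI[of _ "bab (-1) h (- h)"] bexI[of _ "bab 1 (- h) h"]) (auto simp: nup_set_def)
    next
      case 2
      have "bab 1 (- h) h \<otimes> bab (-1) h (- h) = b [^] r \<otimes> b [^] s"
        using babab_collapse_opposite[of 1 "- h" 1 "- h"] 2 by (simp add: bab_mult b_add)
      moreover have "in_strip (-1) h (- h)" "in_strip 1 (- h) h"
        using h by (auto simp: in_strip_def)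
      ultimately show ?thesis
        using bab_neq_b[of 1 r "- h" h]
        by (intro bexI[of _ "bab 1 (- h) h"] bexI[of _ "bab (-1) h (- h)"]) (auto simp: nup_set_def)
    next
      case 3
      have "\<alpha> (b [^] s) \<noteq> \<alpha> (b [^] r)"
        using 3 \<open>r \<noteq> 0\<close> by simp
      then have "b [^] s \<noteq> b [^] r" by metis
      moreover have "b [^] s \<otimes> b [^] r = b [^] r \<otimes> b [^] s"
        by (simp add: b_add add.commute)
      ultimately show ?thesis
        using rs by (intro bexI[of _ "b [^] s"] bexI[of _ "b [^] r"]) (auto simp: nup_set_def)
    qed
  qed
  have mixed: "b [^] r \<otimes> bab e i j = bab e i j \<otimes> b [^] (- r)" "b [^] r \<noteq> bab e i j" "b [^] (- r) \<noteq> bab e i j"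
    "b [^] (- r) \<in> nup_set" "b [^] r \<in> nup_set" "bab e i j \<in> nup_set"
    if "r \<in> {2 * h, - (2 * h)}" "in_strip e i j" for r e i j
    using that c_bab[of e 1 i j] c_bab[of e "-1" i j] bab_neq_b[of e _ i j]
    by (auto simp: nup_set_def in_strip_def)
  from assms consider
      (cc) r s where "x = b [^] r" "y = b [^] s" "r \<in> {2 * h, - (2 * h)}" "s \<in> {2 * h, - (2 * h)}"
    | (cv) r e i j where "x = b [^] r" "y = bab e i j" "r \<in> {2 * h, - (2 * h)}" "in_strip e i j"
    | (vc) r e i j where "x = bab e i j" "y = b [^] (- r)" "r \<in> {2 * h, - (2 * h)}" "in_strip e i j"
    | (vv) e i j f k l where "x = bab e i j" "y = bab f k l" "in_strip e i j" "in_strip f k l"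
    unfolding nup_set_def by auto (metis minus_minus)+
  then show ?thesis
  proof cases
    case cc
    then show ?thesis using corner by blast
  next
    case cv
    then show ?thesis using mixed[of r e i j] by (metis prod.inject)
  next
    case vc
    then show ?thesis using mixed[of r e i j] by (metis prod.inject)
  next
    case vv
    then show ?thesis using nup_set_bab_bab[of e i j f k l] by (metis prod.inject)
  qed
qed

theorem not_unique_product: "\<not> unique_product_property G"
proof
  assume "unique_product_property G"
  moreover have "nup_set \<subseteq> carrier G" "nup_set \<noteq> {}"
    by (auto simp: nup_set_def)
  ultimately obtain z where z: "z \<in> nup_set <#> nup_set"
    "\<exists>!p. p \<in> nup_set \<times> nup_set \<and> z = fst p \<otimes> snd p"
    unfolding unique_product_property_def using finite_nup_set by metis
  then obtain x y where "x \<in> nup_set" "y \<in> nup_set" "z = x \<otimes> y"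
    by (auto simp: set_mult_def)
  with z(2) nup_set_no_unique_product[of x y] show False
    by (metis (no_types, lifting) SigmaI fst_conv snd_conv)
qed

end


section \<open>Unimodular real matrices\<close>

type_synonym mat2 = "real \<times> real \<times> real \<times> real"

text \<open>Matrices are listed row by row.\<close>

definition SL2 :: "mat2 monoid" where
  "SL2 = \<lparr>carrier = {(p, q, r, s). p * s - q * r = 1},
     monoid.mult = (\<lambda>(p, q, r, s) (p', q', r', s').
       (p * p' + q * r', p * q' + q * s', r * p' + s * r', r * q' + s * s')),
     monoid.one = (1, 0, 0, 1)\<rparr>"

abbreviation neg_one :: mat2 where
  "neg_one \<equiv> (-1, 0, 0, -1)"

lemma SL2_carrier [simp]: "(p, q, r, s) \<in> carrier SL2 \<longleftrightarrow> p * s - q * r = 1"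
  by (simp add: SL2_def)

lemma SL2_mult [simp]:
  "(p, q, r, s) \<otimes>\<^bsub>SL2\<^esub> (p', q', r', s') =
     (p * p' + q * r', p * q' + q * s', r * p' + s * r', r * q' + s * s')"
  by (simp add: SL2_def)

lemma SL2_one: "\<one>\<^bsub>SL2\<^esub> = (1, 0, 0, 1)"
  by (simp add: SL2_def)

lemma group_SL2: "group SL2"
proof (rule groupI)
  fix x y assume xy: "x \<in> carrier SL2" "y \<in> carrier SL2"
  obtain p q r s where x: "x = (p, q, r, s)" by (cases x)
  obtain p' q' r' s' where y: "y = (p', q', r', s')" by (cases y)
  have "(p * p' + q * r') * (r * q' + s * s') - (p * q' + q * s') * (r * p' + s * r') =
      (p * s - q * r) * (p' * s' - q' * r')"
    by algebra
  with xy show "x \<otimes>\<^bsub>SL2\<^esub> y \<in> carrier SL2" by (simp add: x y)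
next
  fix x assume "x \<in> carrier SL2"
  moreover obtain p q r s where "x = (p, q, r, s)" by (cases x)
  ultimately show "\<exists>y\<in>carrier SL2. y \<otimes>\<^bsub>SL2\<^esub> x = \<one>\<^bsub>SL2\<^esub>"
    by (intro bexI[of _ "(s, - q, - r, p)"]) (auto simp: SL2_one algebra_simps)
qed (auto simp: SL2_def algebra_simps)

lemma SL2_inv:
  assumes "(p, q, r, s) \<in> carrier SL2"
  shows "inv\<^bsub>SL2\<^esub> (p, q, r, s) = (s, - q, - r, p)"
  using assms by (intro group.inv_equality[OF group_SL2]) (auto simp: SL2_one algebra_simps)

fun is_scalar :: "mat2 \<Rightarrow> bool" where
  "is_scalar (p, q, r, s) \<longleftrightarrow> q = 0 \<and> r = 0 \<and> p = s"

lemma SL2_scalar: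
  assumes "M \<in> carrier SL2" "is_scalar M"
  shows "M = (1, 0, 0, 1) \<or> M = (-1, 0, 0, -1)"
  using assms by (cases M) (auto simp: square_eq_1_iff)

text \<open>Since \<open>U\<^sup>-\<^sup>1 = tr U - U\<close>, the hypothesis says that \<open>X\<close> anticommutes with the traceless part of \<open>U\<close>. That
  part is non-zero, and anticommuting with a non-zero traceless matrix forces \<open>X\<close> to be traceless as
  well, so that \<open>X\<^sup>2\<close> is scalar by the theorem of Cayley and Hamilton.\<close>

lemma SL2_inverting_imp_scalar_square:
  assumes X: "X \<in> carrier SL2" and U: "U \<in> carrier SL2"
    and inverts: "X \<otimes>\<^bsub>SL2\<^esub> U \<otimes>\<^bsub>SL2\<^esub> inv\<^bsub>SL2\<^esub> X = inv\<^bsub>SL2\<^esub> U"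
    and U2: "\<not> is_scalar (U \<otimes>\<^bsub>SL2\<^esub> U)"
  shows "is_scalar (X \<otimes>\<^bsub>SL2\<^esub> X)"
proof -
  obtain p q r s where x: "X = (p, q, r, s)" by (cases X)
  obtain u v w z where u: "U = (u, v, w, z)" by (cases U)
  have "X \<otimes>\<^bsub>SL2\<^esub> U = inv\<^bsub>SL2\<^esub> U \<otimes>\<^bsub>SL2\<^esub> X"
    using group.inv_solve_right'[OF group_SL2, of "inv\<^bsub>SL2\<^esub> U" "X \<otimes>\<^bsub>SL2\<^esub> U" X]
      X U inverts group.inv_closed[OF group_SL2] monoid.m_closed[OF group.is_monoid[OF group_SL2]]
    by metis
  then have eqs: "p * u + q * w = z * p - v * r" "p * v + q * z = z * q - v * s"
    "r * u + s * w = - w * p + u * r" "r * v + s * z = - w * q + u * s"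
    using U by (auto simp: x u SL2_inv)
  (* The entries of (p + s) times the traceless part of U, the diagonal one being doubled. *)
  have "(p + s) * v = 0" "(p + s) * w = 0"
    using eqs by (simp_all add: algebra_simps)
  moreover have "(p + s) * (u - z) = 0"
    using eqs by (simp add: algebra_simps)
  ultimately have "p + s = 0 \<or> v = 0 \<and> w = 0 \<and> u = z" by auto
  then have "p + s = 0"
    using U2 by (auto simp: u)
  then have "s = - p" by simp
  then show ?thesis by (simp add: x algebra_simps)
qed

text \<open>The final disjunct separates diagonal matrices from scalar ones. It is needed for \<open>h = 1\<close>, where \<open>a b\<close>
  is mapped to a diagonal matrix.\<close>

fun positive_mat :: "mat2 \<Rightarrow> bool" where
  "positive_mat (p, q, r, s) \<longleftrightarrow>
     p > 0 \<and> s > 0 \<and> q \<ge> 0 \<and> r \<ge> 0 \<and> (q > 0 \<or> r > 0 \<or> p > s)"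

text \<open>A positive off-diagonal entry of one factor survives because diagonal entries are positive;
  otherwise both factors are diagonal and the first entry stays dominant.\<close>

lemma positive_mat_mult:
  assumes "positive_mat X" "positive_mat Y"
  shows "positive_mat (X \<otimes>\<^bsub>SL2\<^esub> Y)"
proof -
  obtain p q r s where x: "X = (p, q, r, s)" by (cases X)
  obtain p' q' r' s' where y: "Y = (p', q', r', s')" by (cases Y)
  show ?thesis
  proof (cases "q = 0 \<and> r = 0 \<and> q' = 0 \<and> r' = 0")
    case True
    then show ?thesis using assms by (auto simp: x y intro: mult_strict_mono)
  next
    case False
    then have "q > 0 \<or> r > 0 \<or> q' > 0 \<or> r' > 0" using assms by (auto simp: x y)
    then have "p * q' + q * s' > 0 \<or> r * p' + s * r' > 0"
      using assms by (auto simp: x y intro: add_pos_nonneg add_nonneg_pos)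
    then show ?thesis using assms by (auto simp: x y intro: add_pos_nonneg add_nonneg_pos)
  qed
qed

text \<open>The Chebyshev polynomials of the second kind, evaluated at \<open>cos t\<close>: they are the entries of the
  powers of a matrix with trace \<open>2 cos t\<close> and determinant \<open>1\<close>.\<close>

definition sin_ratio :: "real \<Rightarrow> int \<Rightarrow> real" where
  "sin_ratio t n = sin (of_int n * t) / sin t"

definition elliptic :: "real \<Rightarrow> mat2" where
  "elliptic t = (2 * cos t, 1, -1, 0)"

lemma elliptic_in_SL2 [simp]: "elliptic t \<in> carrier SL2"
  by (simp add: elliptic_def)

lemma elliptic_pow:
  assumes "sin t \<noteq> 0"
  shows "elliptic t [^]\<^bsub>SL2\<^esub> (n::nat) =
    (sin_ratio t (int n + 1), sin_ratio t (int n), - sin_ratio t (int n), - sin_ratio t (int n - 1))"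
proof (induction n)
  case 0
  then show ?case using assms by (simp add: sin_ratio_def SL2_one nat_pow_def)
next
  case (Suc n)
  have rec: "sin_ratio t (m + 1) = 2 * cos t * sin_ratio t m - sin_ratio t (m - 1)" for m :: int
  proof -
    have "sin (of_int m * t + t) + sin (of_int m * t - t) = 2 * cos t * sin (of_int m * t)"
      by (simp add: sin_add sin_diff)
    then show ?thesis
      using assms by (simp add: sin_ratio_def field_simps)
  qed
  have "elliptic t [^]\<^bsub>SL2\<^esub> Suc n = elliptic t [^]\<^bsub>SL2\<^esub> n \<otimes>\<^bsub>SL2\<^esub> elliptic t"
    by (simp add: nat_pow_def)
  also have "\<dots> = (sin_ratio t (int n + 1) * (2 * cos t) - sin_ratio t (int n), sin_ratio t (int n + 1),
     - (sin_ratio t (int n) * (2 * cos t)) + sin_ratio t (int n - 1), - sin_ratio t (int n))"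
    by (simp add: Suc) (simp add: elliptic_def)
  finally show ?case
    using rec[of "int n + 1"] rec[of "int n"] by (simp add: algebra_simps)
qed

lemma elliptic_pow_period:
  assumes "n \<ge> 2"
  shows "elliptic (pi / of_nat n) [^]\<^bsub>SL2\<^esub> (n::nat) = neg_one"
proof -
  let ?t = "pi / of_nat n :: real"
  have "0 < sin ?t"
    using assms by (intro sin_gt_zero) (auto simp: field_simps)
  moreover have "of_int (int n + 1) * ?t = pi + ?t" "of_int (int n) * ?t = pi"
    "of_int (int n - 1) * ?t = pi - ?t"
    using assms by (simp_all add: field_simps)
  ultimately show ?thesis
    by (simp add: elliptic_pow sin_ratio_def)
qed

section \<open>Normal forms modulo the translation lattice\<close>

text \<open>Spares the proof that a set of normal forms is closed under multiplication: closure under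
  multiplication by generators from the left suffices.\<close>

lemma (in group) generate_left_closed:
  assumes "x \<in> generate G S" "y \<in> T" "S \<subseteq> carrier G" "T \<subseteq> carrier G"
    and step: "\<And>s y. s \<in> S \<Longrightarrow> y \<in> T \<Longrightarrow> s \<otimes> y \<in> T"
      "\<And>s y. s \<in> S \<Longrightarrow> y \<in> T \<Longrightarrow> inv s \<otimes> y \<in> T"
  shows "x \<otimes> y \<in> T"
  using assms(1,2)
proof (induction arbitrary: y rule: generate.induct)
  case (eng u v)
  then show ?case
    using generate_in_carrier[OF assms(3)] assms(4) by (simp add: m_assoc subset_iff)
qed (use assms in auto)

context mutually_inverting
begin

definition translation :: "int \<Rightarrow> int \<Rightarrow> 'a" where
  "translation r s = b [^] (2 * h * r) \<otimes> a [^] (2 * s)"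

lemma translation_closed [simp]: "translation r s \<in> carrier G"
  by (simp add: translation_def)

lemma translation_0 [simp]: "translation 0 0 = \<one>"
  by (simp add: translation_def)

lemma translation_mult: "translation r s \<otimes> translation r' s' = translation (r + r') (s + s')"
proof -
  have "a [^] (2 * s) \<otimes> b [^] (2 * h * r') = b [^] (2 * h * r') \<otimes> a [^] (2 * s)"
    using a_past_c[of "2 * s" r'] by simp
  then have "a [^] (2 * s) \<otimes> (b [^] (2 * h * r') \<otimes> a [^] (2 * s')) =
      b [^] (2 * h * r') \<otimes> a [^] (2 * (s + s'))"
    by (simp add: m_assoc[symmetric]) (simp add: m_assoc a_add distrib_left)
  then show ?thesis
    by (simp add: translation_def m_assoc b_add_left distrib_left)
qed

lemma translation_mult_left: "x \<in> carrier G \<Longrightarrow> translation r s \<otimes> (translation r' s' \<otimes> x) = translation (r + r') (s + s') \<otimes> x"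
  by (simp add: translation_mult m_assoc[symmetric])

lemma a_translation: "a [^] (i::int) \<otimes> translation r s = translation (if even i then r else - r) s \<otimes> a [^] i"
proof -
  have "a [^] i \<otimes> translation r s = a [^] i \<otimes> b [^] (2 * h * r) \<otimes> a [^] (2 * s)"
    by (simp add: translation_def m_assoc)
  then show ?thesis by (simp add: a_past_c translation_def m_assoc a_add add.commute)
qed

lemma b_translation: "b [^] (i::int) \<otimes> translation r s = translation r (if even i then s else - s) \<otimes> b [^] i"
proof -
  have "b [^] i \<otimes> translation r s = b [^] (2 * h * r) \<otimes> (b [^] i \<otimes> a [^] (2 * s))"
    by (simp add: translation_def b_add_left add.commute)
  also have "\<dots> = b [^] (2 * h * r) \<otimes> (a [^] (2 * (if even i then s else - s)) \<otimes> b [^] i)"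
    by (simp only: b_past_d)
  finally show ?thesis by (simp add: translation_def m_assoc)
qed

lemma a_translation_left: "x \<in> carrier G \<Longrightarrow>
    a [^] (i::int) \<otimes> (translation r s \<otimes> x) = translation (if even i then r else - r) s \<otimes> (a [^] i \<otimes> x)"
  using a_translation[of i r s] by (simp add: m_assoc[symmetric])

lemma b_translation_left: "x \<in> carrier G \<Longrightarrow>
    b [^] (i::int) \<otimes> (translation r s \<otimes> x) = translation r (if even i then s else - s) \<otimes> (b [^] i \<otimes> x)"
  using b_translation[of i r s] by (simp add: m_assoc[symmetric])

lemma a_split_parity: "a [^] (t::int) = translation 0 (t div 2) \<otimes> a [^] (t mod 2)"
  by (simp add: translation_def a_add)

lemma b_split_period: "b [^] (i::int) = translation (i div (2 * h)) 0 \<otimes> b [^] (i mod (2 * h))"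
  by (simp add: translation_def b_add)

definition lattice :: "'a set" where
  "lattice = {translation r s |r s. True}"

lemma translation_in_lattice [simp]: "translation r s \<in> lattice"
  by (auto simp: lattice_def)

primrec ab_word :: "int list \<Rightarrow> 'a" where
  "ab_word [] = \<one>"
| "ab_word (i # is) = a \<otimes> (b [^] i \<otimes> ab_word is)"

definition reduced :: "int list \<Rightarrow> bool" where
  "reduced is \<longleftrightarrow> (\<forall>i\<in>set is. 0 < i \<and> i < 2 * h)"

lemma reduced_simps [simp]:
  "reduced []" "reduced (i # is) \<longleftrightarrow> 0 < i \<and> i < 2 * h \<and> reduced is"
  "reduced (is @ js) \<longleftrightarrow> reduced is \<and> reduced js"
  by (auto simp: reduced_def)

lemma ab_word_closed [simp]: "ab_word is \<in> carrier G"
  by (induction "is") auto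

lemma ab_word_append: "ab_word (is @ js) = ab_word is \<otimes> ab_word js"
  by (induction "is") (simp_all add: m_assoc)

lemma ab_word_translation: "\<exists>r' s'. ab_word is \<otimes> translation r s = translation r' s' \<otimes> ab_word is"
proof (induction "is" arbitrary: r s)
  case (Cons i "is")
  obtain r' s' where "ab_word is \<otimes> translation r s = translation r' s' \<otimes> ab_word is"
    using Cons by blast
  then have "ab_word (i # is) \<otimes> translation r s = a [^] (1::int) \<otimes> (b [^] i \<otimes> (translation r' s' \<otimes> ab_word is))"
    by (simp add: m_assoc)
  also have "\<dots> = translation (- r') (if even i then s' else - s') \<otimes> ab_word (i # is)"
    by (simp add: b_translation_left a_translation_left del: int_pow_1) simp
  finally show ?case by blast
qed auto

text \<open>Only the inner exponents are restricted: \<open>b\<^sup>i\<close> and \<open>a\<^sup>t\<close> may contain powers of \<open>c\<close> and \<open>d\<close>, so that an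
  element has many normal forms.\<close>

definition normal_forms :: "'a set" where
  "normal_forms =
     {translation r s \<otimes> (b [^] i \<otimes> (ab_word is \<otimes> a [^] t)) |r s (i::int) is (t::int). reduced is}"

lemma normal_formsI:
  "reduced is \<Longrightarrow> translation r s \<otimes> (b [^] (i::int) \<otimes> (ab_word is \<otimes> a [^] (t::int))) \<in> normal_forms"
  unfolding normal_forms_def by blast

lemma normal_formsE:
  assumes "x \<in> normal_forms"
  obtains r s i "is" t where "x = translation r s \<otimes> (b [^] (i::int) \<otimes> (ab_word is \<otimes> a [^] (t::int)))" "reduced is"
  using assms unfolding normal_forms_def by blast

lemma normal_forms_b:
  assumes "x \<in> normal_forms"
  shows "b [^] (j::int) \<otimes> x \<in> normal_forms"
  using assms by (auto elim!: normal_formsE intro!: normal_formsI simp: b_translation_left b_add_left)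

lemma normal_forms_translation:
  assumes "x \<in> normal_forms"
  shows "translation r s \<otimes> x \<in> normal_forms"
  using assms by (auto elim!: normal_formsE intro!: normal_formsI simp: translation_mult_left)

text \<open>A new letter \<open>a\<close> either lengthens the word, or it meets another letter \<open>a\<close> and forms \<open>d\<close>.\<close>

lemma normal_forms_a_aux:
  assumes "reduced is" "0 \<le> i" "i < 2 * h"
  shows "a \<otimes> (b [^] i \<otimes> (ab_word is \<otimes> a [^] (t::int))) \<in> normal_forms"
proof (cases "i = 0")
  case False
  then show ?thesis
    using assms normal_formsI[of "i # is" 0 0 0 t] by (simp add: m_assoc)
next
  case True
  show ?thesis
  proof (cases "is")
    case Nil
    have "a \<otimes> a [^] t = a [^] (1 + t)"
      using a_add[of 1 t] by simp
    then show ?thesis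
      using True Nil normal_formsI[of "[]" 0 0 0 "1 + t"] by simp
  next
    case (Cons j js)
    have "a \<otimes> (a \<otimes> x) = translation 0 1 \<otimes> x" if "x \<in> carrier G" for x
      using that a_add_left[of x 1 1] by (simp add: translation_def)
    then show ?thesis
      using True Cons assms normal_formsI[of js 0 1 j t] by (simp add: m_assoc)
  qed
qed

lemma normal_forms_a:
  assumes "odd e" "x \<in> normal_forms"
  shows "a [^] (e::int) \<otimes> x \<in> normal_forms"
proof -
  obtain r s i "is" t
    where x: "x = translation r s \<otimes> (b [^] (i::int) \<otimes> (ab_word is \<otimes> a [^] (t::int)))" "reduced is"
    using assms(2) by (rule normal_formsE)
  have e: "a [^] e = translation 0 (e div 2) \<otimes> a"
    using a_split_parity[of e] assms by (simp add: odd_iff_mod_2_eq_one)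
  have i: "b [^] i = translation (i div (2 * h)) 0 \<otimes> b [^] (i mod (2 * h))"
    by (rule b_split_period)
  have a': "a \<otimes> (translation r s \<otimes> y) = translation (- r) s \<otimes> (a \<otimes> y)" if "y \<in> carrier G" for r s y
    using a_translation_left[OF that, of 1 r s] that by simp
  have "a [^] e \<otimes> x = translation 0 (e div 2) \<otimes> (translation (- (r + i div (2 * h))) s \<otimes>
      (a \<otimes> (b [^] (i mod (2 * h)) \<otimes> (ab_word is \<otimes> a [^] t))))"
    unfolding x(1) e by (subst i) (simp add: m_assoc translation_mult_left a')
  then show ?thesis
    using normal_forms_a_aux[OF x(2), of "i mod (2 * h)" t] h
    by (simp add: normal_forms_translation)
qed


text \<open>This is normality of the lattice, phrased so that translations can be collected on the left.\<close>

lemma normal_forms_commute_translation: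
  assumes "x \<in> normal_forms"
  shows "\<exists>r' s'. x \<otimes> translation r s = translation r' s' \<otimes> x"
proof -
  obtain r1 s1 i "is" t
    where x: "x = translation r1 s1 \<otimes> (b [^] (i::int) \<otimes> (ab_word is \<otimes> a [^] (t::int)))"
    using assms by (rule normal_formsE)
  obtain r2 s2 where W: "ab_word is \<otimes> translation (if even t then r else - r) s = translation r2 s2 \<otimes> ab_word is"
    using ab_word_translation by blast
  have W': "ab_word is \<otimes> (translation (if even t then r else - r) s \<otimes> y) = translation r2 s2 \<otimes> (ab_word is \<otimes> y)"
    if "y \<in> carrier G" for y
    using W that by (simp add: m_assoc[symmetric] del: if_split)
  have "x \<otimes> translation r s = translation r1 s1 \<otimes> (b [^] i \<otimes> (ab_word is \<otimes> (a [^] t \<otimes> translation r s)))"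
    by (simp add: x m_assoc)
  also have "\<dots> = translation r1 s1 \<otimes> (b [^] i \<otimes> (translation r2 s2 \<otimes> (ab_word is \<otimes> a [^] t)))"
    by (simp only: a_translation W' int_pow_closed a)
  also have "\<dots> = translation r2 (if even i then s2 else - s2) \<otimes> x"
    by (simp add: x b_translation_left translation_mult_left add.commute)
  finally show ?thesis by blast
qed

definition conjugate :: "'a \<Rightarrow> 'a \<Rightarrow> bool" where
  "conjugate x y \<longleftrightarrow> (\<exists>u\<in>carrier G. y = u \<otimes> x \<otimes> inv u)"

lemma conjugate_refl: "x \<in> carrier G \<Longrightarrow> conjugate x x"
  by (auto simp: conjugate_def intro!: bexI[of _ \<one>])

lemma conjugate_trans:
  assumes "x \<in> carrier G" "conjugate x y" "conjugate y z"
  shows "conjugate x z"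
proof -
  obtain u v where uv: "u \<in> carrier G" "v \<in> carrier G" "y = u \<otimes> x \<otimes> inv u" "z = v \<otimes> y \<otimes> inv v"
    using assms by (auto simp: conjugate_def)
  then have "z = (v \<otimes> u) \<otimes> x \<otimes> inv (v \<otimes> u)"
    using assms(1) by (simp add: m_assoc inv_mult_group)
  then show ?thesis using uv by (auto simp: conjugate_def)
qed

lemma conjugate_swap:
  assumes "x \<in> carrier G" "y \<in> carrier G"
  shows "conjugate (x \<otimes> y) (y \<otimes> x)"
proof -
  have "inv x \<otimes> (x \<otimes> y) \<otimes> inv (inv x) = (inv x \<otimes> x) \<otimes> y \<otimes> x"
    using assms by (simp only: m_assoc m_closed inv_closed inv_inv)
  then show ?thesis
    using assms by (auto simp: conjugate_def intro!: bexI[of _ "inv x"])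
qed

text \<open>Representatives, modulo the lattice, of the conjugacy classes in the free product: the elements of
  finite order and the cyclically reduced words of positive length.\<close>

inductive_set cyclic_forms :: "'a set" where
  rotation: "translation r s \<otimes> b [^] (i::int) \<in> cyclic_forms"
| reflection: "translation r s \<otimes> a \<in> cyclic_forms"
| hyperbolic: "reduced is \<Longrightarrow> is \<noteq> [] \<Longrightarrow> translation r s \<otimes> ab_word is \<in> cyclic_forms"

text \<open>Cyclic reduction. The last letter is moved to the front and merged with the first one. If they
  cancel modulo the lattice the word becomes shorter, otherwise it is cyclically reduced.\<close>

lemma conjugate_cyclic_form_aux:
  assumes "reduced is" "t \<in> {0, 1}"
  shows "\<exists>y\<in>cyclic_forms. conjugate (translation r s \<otimes> (b [^] (i::int) \<otimes> (ab_word is \<otimes> a [^] (t::int)))) y"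
  using assms
proof (induction "length is" arbitrary: "is" r s i t rule: less_induct)
  case less
  let ?g = "translation r s \<otimes> (b [^] i \<otimes> (ab_word is \<otimes> a [^] t))"
  let ?i = "i mod (2 * h)"
  have reduce: ?case if red: "conjugate ?g y" "y = translation r' s' \<otimes> (b [^] i' \<otimes> (ab_word js \<otimes> a [^] t'))"
    "length js < length is" "reduced js" "t' \<in> {0, 1}" for y r' s' and i' :: int and js and t' :: int
  proof -
    obtain z where "z \<in> cyclic_forms" "conjugate y z"
      using less(1)[OF red(3-5)] red(2) by blast
    then show ?thesis using conjugate_trans[of ?g y z] red(1) by auto
  qed
  have mod_pos: "0 < k mod (2 * h)" if "k mod (2 * h) \<noteq> 0" for k
    using that h pos_mod_sign[of "2 * h" k] by linarith
  from less(3) consider "t = 0" | "t = 1" by blast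
  then show ?case
  proof cases
    case 1
    have swap: "conjugate ?g (ab_word is \<otimes> (translation r s \<otimes> b [^] i))"
      using conjugate_swap[of "translation r s \<otimes> b [^] i" "ab_word is"] 1 by (simp add: m_assoc)
    show ?thesis
    proof (cases "is" rule: rev_cases)
      case Nil
      then show ?thesis
        using 1 conjugate_refl[of ?g] rotation[of r s i] by auto
    next
      case (snoc js j)
      let ?n = "(j + i) mod (2 * h)" and ?q = "(j + i) div (2 * h)"
      obtain r1 s1 where 1: "ab_word (js @ [j]) \<otimes> translation r s = translation r1 s1 \<otimes> ab_word (js @ [j])"
        using ab_word_translation by blast
      obtain r2 s2 where 2: "ab_word (js @ [0]) \<otimes> translation ?q 0 = translation r2 s2 \<otimes> ab_word (js @ [0])"
        using ab_word_translation by blast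
      have "ab_word is \<otimes> (translation r s \<otimes> b [^] i) = ab_word (js @ [j]) \<otimes> translation r s \<otimes> b [^] i"
        by (simp add: snoc m_assoc)
      also have "\<dots> = translation r1 s1 \<otimes> (ab_word (js @ [0]) \<otimes> b [^] (j + i))"
        unfolding 1 by (simp add: ab_word_append m_assoc b_add)
      also have "b [^] (j + i) = translation ?q 0 \<otimes> b [^] ?n"
        by (rule b_split_period)
      also have "ab_word (js @ [0]) \<otimes> (translation ?q 0 \<otimes> b [^] ?n) =
          ab_word (js @ [0]) \<otimes> translation ?q 0 \<otimes> b [^] ?n"
        by (simp add: m_assoc)
      finally have cyc: "ab_word is \<otimes> (translation r s \<otimes> b [^] i) =
          translation (r1 + r2) (s1 + s2) \<otimes> ab_word (js @ [?n])"
        unfolding 2 by (simp add: translation_mult_left ab_word_append m_assoc)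
      have js: "reduced js" using less(2) snoc by simp
      show ?thesis
      proof (cases "?n = 0")
        case True
        have "ab_word (js @ [0]) = b [^] (0::int) \<otimes> (ab_word js \<otimes> a [^] (1::int))"
          by (simp add: ab_word_append)
        then show ?thesis
          using reduce[OF swap, of "r1 + r2" "s1 + s2" 0 js 1] cyc True js snoc by simp
      next
        case False
        then have "reduced (js @ [?n])" using js h mod_pos by simp
        then show ?thesis
          using swap hyperbolic[of "js @ [?n]" "r1 + r2" "s1 + s2"] cyc by auto
      qed
    qed
  next
    case 2
    let ?X = "translation (r + i div (2 * h)) s \<otimes> (b [^] ?i \<otimes> ab_word is)"
    have "?g = ?X \<otimes> a"
      using 2 by (subst b_split_period) (simp add: m_assoc translation_mult_left)
    moreover have "a \<otimes> ?X = translation (- (r + i div (2 * h))) s \<otimes> ab_word (?i # is)"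
      using a_translation_left[of _ 1] by simp
    ultimately have swap: "conjugate ?g (translation (- (r + i div (2 * h))) s \<otimes> ab_word (?i # is))"
      using conjugate_swap[of ?X a] by simp
    show ?thesis
    proof (cases "?i = 0")
      case False
      then have "reduced (?i # is)" using less(2) h mod_pos by simp
      then show ?thesis using swap hyperbolic by blast
    next
      case True
      show ?thesis
      proof (cases "is")
        case Nil
        then show ?thesis using True swap reflection by auto
      next
        case (Cons j js)
        have "a \<otimes> (a \<otimes> x) = translation 0 1 \<otimes> x" if "x \<in> carrier G" for x
          using that a_add_left[of x 1 1] by (simp add: translation_def)
        then have "translation (- (r + i div (2 * h))) s \<otimes> ab_word (?i # is) =
            translation (- (r + i div (2 * h))) (s + 1) \<otimes> (b [^] j \<otimes> (ab_word js \<otimes> a [^] (0::int)))"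
          using True Cons by (simp add: translation_mult_left)
        then show ?thesis
          using reduce[OF swap, of _ _ j js 0] less(2) Cons by simp
      qed
    qed
  qed
qed

lemma conjugate_cyclic_form:
  assumes "x \<in> normal_forms"
  shows "\<exists>y\<in>cyclic_forms. conjugate x y"
proof -
  obtain r s i "is" t
    where x: "x = translation r s \<otimes> (b [^] (i::int) \<otimes> (ab_word is \<otimes> a [^] (t::int)))" "reduced is"
    using assms by (rule normal_formsE)
  obtain r' s' where W: "ab_word is \<otimes> translation 0 (t div 2) = translation r' s' \<otimes> ab_word is"
    using ab_word_translation by blast
  have "ab_word is \<otimes> a [^] t = ab_word is \<otimes> translation 0 (t div 2) \<otimes> a [^] (t mod 2)"
    by (subst a_split_parity) (simp add: m_assoc)
  then have "x = translation (r + r') (s + (if even i then s' else - s')) \<otimes>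
      (b [^] i \<otimes> (ab_word is \<otimes> a [^] (t mod 2)))"
    unfolding x W by (simp add: m_assoc b_translation_left translation_mult_left)
  moreover have "t mod 2 \<in> {0, 1}" by auto
  ultimately show ?thesis
    using conjugate_cyclic_form_aux[OF x(2)] by metis
qed

end


section \<open>Torsion\<close>

lemma subgroup_centre_SL2: "subgroup {\<one>\<^bsub>SL2\<^esub>, neg_one} SL2"
  by (rule group.subgroupI[OF group_SL2]) (auto simp: SL2_one SL2_inv)

text \<open>Elements of the lattice are mapped to \<open>1\<close> or \<open>-1\<close>, so positivity is only meaningful up to sign.\<close>

fun neg_mat :: "mat2 \<Rightarrow> mat2" where
  "neg_mat (p, q, r, s) = (- p, - q, - r, - s)"

lemma neg_mat_mult:
  "neg_mat X \<otimes>\<^bsub>SL2\<^esub> Y = neg_mat (X \<otimes>\<^bsub>SL2\<^esub> Y)" "X \<otimes>\<^bsub>SL2\<^esub> neg_mat Y = neg_mat (X \<otimes>\<^bsub>SL2\<^esub> Y)"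
  by (cases X; cases Y; simp)+

lemma neg_mat_neg_mat [simp]: "neg_mat (neg_mat X) = X"
  by (cases X) simp

definition definite_mat :: "mat2 \<Rightarrow> bool" where
  "definite_mat X \<longleftrightarrow> positive_mat X \<or> positive_mat (neg_mat X)"

lemma definite_mat_mult:
  assumes "definite_mat X" "definite_mat Y"
  shows "definite_mat (X \<otimes>\<^bsub>SL2\<^esub> Y)"
  using assms positive_mat_mult[of X Y] positive_mat_mult[of X "neg_mat Y"]
    positive_mat_mult[of "neg_mat X" Y] positive_mat_mult[of "neg_mat X" "neg_mat Y"]
  by (auto simp: definite_mat_def neg_mat_mult)

lemma definite_mat_not_scalar: "definite_mat X \<Longrightarrow> \<not> is_scalar X"
  by (cases X) (auto simp: definite_mat_def)

text \<open>The matrix of \<open>b\<close> is elliptic with \<open>b\<^bsup>2 h\<^esup>\<close> acting as \<open>-1\<close>, and \<open>a\<^sup>2\<close> acts as \<open>-1\<close> as well. The entries \<open>-2\<close> and \<open>1 / 2\<close>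
  in the matrix of \<open>a\<close>, instead of \<open>-1\<close> and \<open>1\<close>, keep the matrix of \<open>a b\<close> from being scalar when \<open>h = 1\<close>.\<close>

locale acting_on_plane = acting_on_lines +
  fixes \<phi> :: "'a \<Rightarrow> mat2"
  assumes \<phi>_hom: "\<phi> \<in> hom G SL2" and \<phi>_a: "\<phi> a = (0, -2, 1 / 2, 0)"
    and \<phi>_b: "\<phi> b = elliptic (pi / of_int (2 * h))"
    and generated: "generate G {a, b} = carrier G"
begin

sublocale \<phi>: group_hom G SL2 \<phi>
  by (intro group_hom.intro group_hom_axioms.intro group_SL2 is_group \<phi>_hom)

lemma in_normal_forms:
  assumes "x \<in> carrier G"
  shows "x \<in> normal_forms"
proof -
  have "x \<otimes> \<one> \<in> normal_forms"
  proof (rule generate_left_closed[of x "{a, b}"])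
    show "\<one> \<in> normal_forms"
      using normal_formsI[of "[]" 0 0 0 0] by simp
    show "normal_forms \<subseteq> carrier G"
      by (auto elim: normal_formsE)
    show "s \<otimes> y \<in> normal_forms" "inv s \<otimes> y \<in> normal_forms"
      if "s \<in> {a, b}" "y \<in> normal_forms" for s y
      using that normal_forms_a[of 1 y] normal_forms_a[of "-1" y]
        normal_forms_b[of y 1] normal_forms_b[of y "-1"] by (auto simp: int_pow_neg)
  qed (use assms generated in auto)
  then show ?thesis using assms by simp
qed

lemma lattice_normal:
  assumes "u \<in> carrier G" "x \<in> lattice"
  shows "u \<otimes> x \<otimes> inv u \<in> lattice"
proof -
  obtain r s where x: "x = translation r s" using assms by (auto simp: lattice_def)
  obtain r' s' where "u \<otimes> translation r s = translation r' s' \<otimes> u"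
    using normal_forms_commute_translation[OF in_normal_forms[OF assms(1)]] by blast
  then show ?thesis using assms by (simp add: x m_assoc)
qed

definition angle :: real where
  "angle = pi / of_int (2 * h)"

abbreviation ratio :: "int \<Rightarrow> real" where
  "ratio \<equiv> sin_ratio angle"

lemma ratio_pos:
  assumes "0 < i" "i < 2 * h"
  shows "ratio i > 0"
proof -
  have "0 < sin (of_int j * angle)" if "0 < j" "j < 2 * h" for j :: int
  proof (rule sin_gt_zero)
    have "of_int j < (of_int (2 * h) :: real)" using that by linarith
    then show "of_int j * angle < pi"
      using h by (simp add: angle_def field_simps)
  qed (use that h in \<open>simp add: angle_def\<close>)
  from this[of i] this[of 1] assms h show ?thesis
    by (simp add: sin_ratio_def)
qed

lemma sin_angle_nonzero: "sin angle \<noteq> 0"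
  using ratio_pos[of 1] h by (auto simp: sin_ratio_def)

lemma ratio_0 [simp]: "ratio 0 = 0"
  by (simp add: sin_ratio_def)

lemma ratio_period: "ratio (2 * h) = 0"
  using h by (simp add: sin_ratio_def angle_def)

lemma ratio_nonneg: "0 \<le> i \<Longrightarrow> i \<le> 2 * h \<Longrightarrow> ratio i \<ge> 0"
  using ratio_pos[of i] ratio_period by (cases "i = 0"; cases "i = 2 * h") auto

lemma \<phi>_b_pow_elliptic:
  assumes "0 \<le> i"
  shows "\<phi> (b [^] (i::int)) = elliptic angle [^]\<^bsub>SL2\<^esub> nat i"
  using assms \<phi>.hom_int_pow[of b i] by (simp only: b \<phi>_b int_pow_def2 angle_def) simp

lemma \<phi>_b_pow:
  assumes "0 \<le> i"
  shows "\<phi> (b [^] (i::int)) = (ratio (i + 1), ratio i, - ratio i, - ratio (i - 1))"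
  unfolding \<phi>_b_pow_elliptic[OF assms] elliptic_pow[OF sin_angle_nonzero] using assms by simp

lemma \<phi>_translation: "\<phi> (translation r s) \<in> {\<one>\<^bsub>SL2\<^esub>, neg_one}"
proof -
  have "angle = pi / of_nat (nat (2 * h))"
    using h by (simp add: angle_def)
  then have "\<phi> (b [^] (2 * h)) = neg_one"
    using elliptic_pow_period[of "nat (2 * h)"] h \<phi>_b_pow_elliptic[of "2 * h"] by simp
  moreover have "\<phi> (a [^] (2::int)) = neg_one"
    using a_add[of 1 1] \<phi>.hom_mult[of a a] by (simp add: \<phi>_a)
  moreover have "translation r s = (b [^] (2 * h)) [^] r \<otimes> (a [^] (2::int)) [^] s"
    by (simp add: translation_def int_pow_pow)
  ultimately have eq: "\<phi> (translation r s) = neg_one [^]\<^bsub>SL2\<^esub> r \<otimes>\<^bsub>SL2\<^esub> neg_one [^]\<^bsub>SL2\<^esub> s"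
    by (simp add: \<phi>.hom_int_pow)
  have pow: "neg_one [^]\<^bsub>SL2\<^esub> n \<in> {\<one>\<^bsub>SL2\<^esub>, neg_one}" for n :: int
    by (rule group.subgroup_int_pow_closed[OF group_SL2 subgroup_centre_SL2]) blast
  show ?thesis
    unfolding eq by (rule subgroup.m_closed[OF subgroup_centre_SL2 pow pow])
qed

text \<open>The matrix of \<open>a b\<^sup>i\<close> has as entries positive multiples of sines of angles between \<open>0\<close> and \<open>\<pi>\<close>.\<close>

lemma \<phi>_ab_word:
  assumes "reduced is" "is \<noteq> []"
  shows "positive_mat (\<phi> (ab_word is))"
  using assms
proof (induction "is")
  case (Cons i "is")
  have "\<phi> (a \<otimes> b [^] i) = (2 * ratio i, 2 * ratio (i - 1), ratio (i + 1) / 2, ratio i / 2)"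
    using Cons by (simp add: \<phi>_b_pow \<phi>_a)
  then have pos: "positive_mat (\<phi> (a \<otimes> b [^] i))"
    using Cons ratio_pos[of i] ratio_nonneg[of "i + 1"] ratio_nonneg[of "i - 1"] by simp
  have "\<phi> (ab_word (i # is)) = \<phi> (a \<otimes> b [^] i) \<otimes>\<^bsub>SL2\<^esub> \<phi> (ab_word is)"
    by (simp add: m_assoc flip: \<phi>.hom_mult)
  then show ?case
    using Cons pos positive_mat_mult[OF pos] by (cases "is") (auto simp: m_assoc)
qed simp

lemma hyperbolic_definite:
  assumes "reduced is" "is \<noteq> []"
  shows "definite_mat (\<phi> (translation r s \<otimes> ab_word is))"
proof -
  obtain p q p' q' where M: "\<phi> (ab_word is) = (p, q, p', q')"
    by (cases "\<phi> (ab_word is)")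
  show ?thesis
    using \<phi>_ab_word[OF assms] \<phi>_translation[of r s] by (auto simp: definite_mat_def M SL2_one)
qed

lemma conjugate_iff_lattice:
  assumes "x \<in> carrier G" "conjugate x y"
  shows "y \<in> lattice \<longleftrightarrow> x \<in> lattice"
proof -
  obtain u where u: "u \<in> carrier G" "y = u \<otimes> x \<otimes> inv u"
    using assms by (auto simp: conjugate_def)
  have "inv u \<otimes> y \<otimes> inv (inv u) = (inv u \<otimes> u) \<otimes> x \<otimes> (inv u \<otimes> u)"
    using u(1) assms(1) unfolding u(2) by (simp only: m_assoc m_closed inv_closed inv_inv)
  then have "inv u \<otimes> y \<otimes> inv (inv u) = x"
    using u assms by simp
  then show ?thesis
    using u lattice_normal[of u x] lattice_normal[of "inv u" y] by auto
qed

text \<open>Being scalar is invariant under conjugation, so it suffices to inspect the cyclic forms: those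
  outside the lattice are mapped to non-scalar matrices.\<close>

lemma scalar_imp_lattice:
  assumes x: "x \<in> carrier G" and scalar: "is_scalar (\<phi> x)"
  shows "x \<in> lattice"
proof -
  obtain y where y: "y \<in> cyclic_forms" "conjugate x y"
    using conjugate_cyclic_form[OF in_normal_forms[OF x]] by blast
  obtain u where u: "u \<in> carrier G" "y = u \<otimes> x \<otimes> inv u"
    using y by (auto simp: conjugate_def)
  have "\<phi> x = (1, 0, 0, 1) \<or> \<phi> x = neg_one"
    using SL2_scalar[OF _ scalar] x by simp
  moreover obtain p q r s where "\<phi> u = (p, q, r, s)" by (cases "\<phi> u")
  ultimately have "\<phi> u \<otimes>\<^bsub>SL2\<^esub> \<phi> x = \<phi> x \<otimes>\<^bsub>SL2\<^esub> \<phi> u"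
    by auto
  then have "\<phi> y = \<phi> x"
    using u x by (simp add: \<phi>.H.m_assoc)
  with scalar have scalar_y: "is_scalar (\<phi> y)" by simp
  have "y \<in> lattice"
    using y(1)
  proof cases
    case (rotation r s i)
    obtain p q p' q' where M: "\<phi> (b [^] (i mod (2 * h))) = (p, q, p', q')"
      by (cases "\<phi> (b [^] (i mod (2 * h)))")
    have y': "y = translation (r + i div (2 * h)) s \<otimes> b [^] (i mod (2 * h))"
      unfolding rotation by (subst b_split_period) (simp add: translation_mult_left)
    then have "is_scalar (p, q, p', q')"
      using scalar_y \<phi>_translation[of "r + i div (2 * h)" s] M by (auto simp: SL2_one)
    moreover have "q = ratio (i mod (2 * h))"
      using M \<phi>_b_pow[of "i mod (2 * h)"] h by simp
    ultimately have "\<not> 0 < i mod (2 * h)"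
      using ratio_pos[of "i mod (2 * h)"] h by auto
    then have "i mod (2 * h) = 0"
      using h pos_mod_sign[of "2 * h" i] by linarith
    then show ?thesis using y' by simp
  next
    case (reflection r s)
    then have False
      using scalar_y \<phi>_translation[of r s] by (auto simp: \<phi>_a SL2_one)
    then show ?thesis ..
  next
    case (hyperbolic "is" r s)
    then show ?thesis
      using scalar_y hyperbolic_definite definite_mat_not_scalar by blast
  qed
  then show ?thesis using conjugate_iff_lattice x y by blast
qed

lemma \<alpha>_translation [simp]: "\<alpha> (translation r s) = (1, 2 * h * r)"
  by (simp add: translation_def)

lemma \<beta>_translation [simp]: "\<beta> (translation r s) = (1, 2 * s)"
  by (simp add: translation_def)

lemma definite_mat_pow:
  assumes "definite_mat X" "n > 0" "X \<in> carrier SL2"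
  shows "definite_mat (X [^]\<^bsub>SL2\<^esub> (n::nat))"
  using assms(2)
proof (induction n)
  case (Suc n)
  have "\<one>\<^bsub>SL2\<^esub> \<otimes>\<^bsub>SL2\<^esub> X = X" using assms by (cases X) (simp add: SL2_one)
  then show ?case
    using Suc assms definite_mat_mult by (cases "n = 0") (auto simp: nat_pow_def)
qed simp

lemma conjugate_nat_pow:
  assumes "x \<in> carrier G" "conjugate x y"
  shows "conjugate (x [^] (n::nat)) (y [^] n)"
proof -
  obtain u where u: "u \<in> carrier G" "y = u \<otimes> x \<otimes> inv u"
    using assms by (auto simp: conjugate_def)
  then have "y [^] n = u \<otimes> x [^] n \<otimes> inv u"
    using conj_int_pow[of u x "int n"] assms by (simp add: int_pow_int)
  then show ?thesis using u by (auto simp: conjugate_def)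
qed

text \<open>Torsion is invariant under conjugation. A rotation or reflection of finite order is trivial
  because its image under \<open>\<alpha>\<close> or \<open>\<beta>\<close> is a translation, and in the hyperbolic case no power is mapped to a
  scalar matrix.\<close>

theorem torsion_free: "torsion_free G"
  unfolding torsion_free_def
proof (intro ballI allI impI)
  fix x and n :: nat
  assume x: "x \<in> carrier G" and n: "n > 0" and xn: "x [^] n = \<one>"
  obtain y where y: "y \<in> cyclic_forms" "conjugate x y"
    using conjugate_cyclic_form[OF in_normal_forms[OF x]] by blast
  obtain u where u: "u \<in> carrier G" "y = u \<otimes> x \<otimes> inv u"
    using y by (auto simp: conjugate_def)
  have "y \<in> carrier G" using x u by simp
  have "conjugate \<one> (y [^] n)"
    using conjugate_nat_pow[OF x y(2), of n] xn by simp
  then have yn: "y [^] n = \<one>"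
    by (auto simp: conjugate_def)
  then have \<alpha>n: "\<alpha> y [^]\<^bsub>Aff\<^esub> n = (1, 0)" and \<beta>n: "\<beta> y [^]\<^bsub>Aff\<^esub> n = (1, 0)"
    and \<phi>n: "\<phi> y [^]\<^bsub>SL2\<^esub> n = (1, 0, 0, 1)"
    using \<open>y \<in> carrier G\<close>
    by (simp_all flip: \<alpha>.hom_nat_pow \<beta>.hom_nat_pow \<phi>.hom_nat_pow add: Aff_one SL2_one)
  from y(1) have "y = \<one>"
  proof cases
    case (rotation r s i)
    have "\<alpha> y = (1, 2 * h * r + i)"
      by (simp add: rotation)
    then have i: "i = 2 * h * (- r)"
      using \<alpha>n n by (simp add: Aff_translation_nat_pow)
    then have "b [^] i = translation (- r) 0"
      by (simp add: translation_def)
    then have "y = translation 0 s"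
      by (simp add: rotation translation_mult)
    then have "\<beta> y = (1, 2 * s)" by simp
    then have "s = 0"
      using \<beta>n n by (simp add: Aff_translation_nat_pow)
    with \<open>y = translation 0 s\<close> show ?thesis by simp
  next
    case (reflection r s)
    have "\<beta> y = (1, 2 * s + 1)"
      by (simp add: reflection \<beta>_a)
    then have "2 * s + 1 = 0"
      using \<beta>n n by (simp add: Aff_translation_nat_pow)
    (* The translation length of a reflection under beta is odd. *)
    then have False by presburger
    then show ?thesis ..
  next
    case (hyperbolic "is" r s)
    then have "definite_mat (\<phi> y [^]\<^bsub>SL2\<^esub> n)"
      using hyperbolic_definite definite_mat_pow n \<open>y \<in> carrier G\<close> by simp
    then show ?thesis
      using \<phi>n definite_mat_not_scalar by fastforce
  qed
  show "x = \<one>"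
  proof -
    have "u \<otimes> x = u"
      using \<open>y = \<one>\<close> u x inv_solve_right'[of \<one> "u \<otimes> x" u] by simp
    then show ?thesis using u x by simp
  qed
qed

section \<open>Pairs of elements inverting each other's squares\<close>

lemma square_inverting:
  assumes x: "x \<in> carrier G" and u: "u \<in> carrier G"
    and inverts: "x \<otimes> u \<otimes> inv x = inv u" and u2: "u \<otimes> u \<notin> lattice"
  shows "x \<otimes> x \<in> lattice"
proof -
  have "\<not> is_scalar (\<phi> (u \<otimes> u))"
    using scalar_imp_lattice u u2 by blast
  moreover have "\<phi> x \<otimes>\<^bsub>SL2\<^esub> \<phi> u \<otimes>\<^bsub>SL2\<^esub> inv\<^bsub>SL2\<^esub> \<phi> x = inv\<^bsub>SL2\<^esub> \<phi> u"
    using x u inverts by (metis \<phi>.hom_inv \<phi>.hom_mult inv_closed m_closed)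
  ultimately have "is_scalar (\<phi> (x \<otimes> x))"
    using SL2_inverting_imp_scalar_square[of "\<phi> x" "\<phi> u"] x u by simp
  then show ?thesis using scalar_imp_lattice x by simp
qed

lemma sign_conj:
  assumes "group_hom G Aff f" "x \<in> carrier G" "u \<in> carrier G"
  shows "fst (f (u \<otimes> x \<otimes> inv u)) = fst (f x)"
proof -
  interpret f: group_hom G Aff f by (rule assms)
  have "fst (f u) * fst (f (inv u)) = 1"
    using assms f.hom_mult[of u "inv u"] by (cases "f u"; cases "f (inv u)") (auto simp: Aff_one)
  then show ?thesis
    using assms by (cases "f u"; cases "f (inv u)"; cases "f x") (auto simp: mult.commute mult.left_commute)
qed

text \<open>Modulo the lattice such an element is conjugate to \<open>1\<close>, \<open>a\<close> or \<open>b\<^sup>h\<close>, and for even \<open>h\<close> all of these commute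
  with \<open>d\<close>. This is where \<open>k > 1\<close> enters.\<close>

lemma square_in_lattice_imp_sign:
  assumes "even h" and x: "x \<in> carrier G" "x \<otimes> x \<in> lattice"
  shows "fst (\<beta> x) = 1"
proof -
  obtain y where y: "y \<in> cyclic_forms" "conjugate x y"
    using conjugate_cyclic_form[OF in_normal_forms[OF x(1)]] by blast
  obtain u where u: "u \<in> carrier G" "y = u \<otimes> x \<otimes> inv u"
    using y by (auto simp: conjugate_def)
  have "y \<in> carrier G" using x u by simp
  have "conjugate (x \<otimes> x) (y \<otimes> y)"
    using conjugate_nat_pow[OF x(1) y(2), of 2] x \<open>y \<in> carrier G\<close>
    by (simp add: numeral_2_eq_2)
  then have yy: "y \<otimes> y \<in> lattice"
    using conjugate_iff_lattice[of "x \<otimes> x" "y \<otimes> y"] x by simp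
  from y(1) have "fst (\<beta> y) = 1"
  proof cases
    case (rotation r s i)
    obtain r' s' where "y \<otimes> y = translation r' s'"
      using yy by (auto simp: lattice_def)
    then have "\<alpha> y \<otimes>\<^bsub>Aff\<^esub> \<alpha> y = (1, 2 * h * r')"
      using \<open>y \<in> carrier G\<close> by (simp flip: \<alpha>.hom_mult)
    moreover have "\<alpha> y = (1, 2 * h * r + i)"
      by (simp add: rotation)
    ultimately have "2 * (2 * h * r + i) = 2 * (h * r')" by simp
    then have "i = h * r' - 2 * h * r" by simp
    then have "even i" using assms(1) by simp
    then show ?thesis by (simp add: rotation)
  next
    case (reflection r s)
    then show ?thesis by (simp add: \<beta>_a)
  next
    case (hyperbolic "is" r s)
    obtain r' s' where "y \<otimes> y = translation r' s'"
      using yy by (auto simp: lattice_def)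
    then have "is_scalar (\<phi> (y \<otimes> y))"
      using \<phi>_translation[of r' s'] by (auto simp: SL2_one)
    moreover have "definite_mat (\<phi> (y \<otimes> y))"
      using hyperbolic_definite[of "is" r s] hyperbolic definite_mat_mult \<open>y \<in> carrier G\<close> by simp
    ultimately show ?thesis
      using definite_mat_not_scalar by blast
  qed
  then show ?thesis
    using sign_conj[OF \<beta>.group_hom_axioms x(1) u(1)] u(2) by simp
qed

text \<open>Conjugation by an affine map multiplies a translation by the linear part.\<close>

lemma Aff_conj_translation:
  assumes "group_hom G Aff f" "g \<in> carrier G" "u \<in> carrier G" "f u = (1, t)" "t \<noteq> 0"
  shows "g \<otimes> u \<otimes> inv g = u \<Longrightarrow> fst (f g) = 1"
    "g \<otimes> u \<otimes> inv g = inv u \<Longrightarrow> fst (f g) = -1"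
proof -
  interpret f: group_hom G Aff f by (rule assms)
  obtain e s where g: "f g = (e, s)" by (cases "f g")
  have e: "e = 1 \<or> e = -1" using f.hom_closed[OF assms(2)] by (simp add: g)
  have "f (g \<otimes> u) = (e, s + e * t)" using assms g by simp
  then show "fst (f g) = 1" if "g \<otimes> u \<otimes> inv g = u"
  proof -
    have "g \<otimes> u = u \<otimes> g" using that assms by (metis inv_solve_right' m_closed)
    then have "f (g \<otimes> u) = (e, t + s)" using assms g by simp
    then show ?thesis using \<open>f (g \<otimes> u) = (e, s + e * t)\<close> e assms(5) g by auto
  qed
  show "fst (f g) = -1" if "g \<otimes> u \<otimes> inv g = inv u"
  proof -
    have "g \<otimes> u = inv u \<otimes> g" using that assms by (metis inv_solve_right' m_closed inv_closed)
    moreover have "f (inv u) = (1, - t)"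
    proof -
      have "f (inv u) = inv\<^bsub>Aff\<^esub> (1, t)" using assms by simp
      also have "\<dots> = (1, - t)"
        by (rule group.inv_equality[OF group_Aff]) (auto simp: Aff_one)
      finally show ?thesis .
    qed
    ultimately have "f (g \<otimes> u) = (e, - t + s)" using assms g by simp
    then show ?thesis using \<open>f (g \<otimes> u) = (e, s + e * t)\<close> e assms(5) g by auto
  qed
qed

text \<open>A non-trivial element of the lattice has a non-zero coordinate, and on that coordinate a group
  element acts by the linear part of \<open>\<alpha>\<close> or \<open>\<beta>\<close>.\<close>

lemma lattice_character:
  assumes "u \<in> lattice" "u \<noteq> \<one>"
  obtains f where "f \<in> {\<alpha>, \<beta>}"
    "\<And>g. g \<in> carrier G \<Longrightarrow> g \<otimes> u \<otimes> inv g = u \<Longrightarrow> fst (f g) = 1"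
    "\<And>g. g \<in> carrier G \<Longrightarrow> g \<otimes> u \<otimes> inv g = inv u \<Longrightarrow> fst (f g) = -1"
proof -
  obtain r s where u: "u = translation r s" using assms by (auto simp: lattice_def)
  with assms have "r \<noteq> 0 \<or> s \<noteq> 0" by auto
  then show thesis
  proof
    assume "r \<noteq> 0"
    then show thesis
      using that[of \<alpha>] Aff_conj_translation[OF \<alpha>.group_hom_axioms, of _ u "2 * h * r"] h
      by (simp add: u)
  next
    assume "s \<noteq> 0"
    then show thesis
      using that[of \<beta>] Aff_conj_translation[OF \<beta>.group_hom_axioms, of _ u "2 * s"]
      by (simp add: u)
  qed
qed


lemma square_neq_one: "x \<in> carrier G \<Longrightarrow> x \<noteq> \<one> \<Longrightarrow> x \<otimes> x \<noteq> \<one>"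
  using torsion_free unfolding torsion_free_def
  by (metis nat_pow_Suc nat_pow_0 l_one zero_less_Suc)

lemma inverting_square:
  assumes "g \<in> carrier G" "u \<in> carrier G" "g \<otimes> u \<otimes> inv g = inv u"
  shows "g \<otimes> (u \<otimes> u) \<otimes> inv g = inv (u \<otimes> u)"
  using conj_int_pow[of g u 2] assms int_pow_mult[of u 1 1] int_pow_mult[of "inv u" 1 1]
  by (simp add: inv_mult_group)

lemma commuting_conj:
  assumes "g \<in> carrier G" "u \<in> carrier G" "g \<otimes> u = u \<otimes> g"
  shows "g \<otimes> u \<otimes> inv g = u"
  using assms by (simp add: m_assoc)

text \<open>The coordinate on which \<open>p\<^sup>2\<close> lives is fixed by \<open>p\<close> and inverted by \<open>q\<close>, and for \<open>q\<^sup>2\<close> it is the other way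
  round. So each of the two coordinates is inverted by one of \<open>p\<close>, \<open>q\<close>, whereas both fix the coordinate of
  \<open>\<beta>\<close>.\<close>

lemma no_inverting_pair_in_lattice:
  assumes "even h" and p: "p \<in> carrier G" "p \<noteq> \<one>" "p \<otimes> p \<in> lattice"
    and q: "q \<in> carrier G" "q \<noteq> \<one>" "q \<otimes> q \<in> lattice"
    and pq: "p \<otimes> (q \<otimes> q) \<otimes> inv p = inv (q \<otimes> q)" "q \<otimes> (p \<otimes> p) \<otimes> inv q = inv (p \<otimes> p)"
  shows False
proof -
  obtain f where "f \<in> {\<alpha>, \<beta>}" "fst (f p) = 1" "fst (f q) = -1"
    using lattice_character[OF p(3) square_neq_one[OF p(1,2)]] p(1) q(1) pq(2)
      commuting_conj[of p "p \<otimes> p"] by (metis m_assoc m_closed)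
  moreover obtain f' where "f' \<in> {\<alpha>, \<beta>}" "fst (f' q) = 1" "fst (f' p) = -1"
    using lattice_character[OF q(3) square_neq_one[OF q(1,2)]] p(1) q(1) pq(1)
      commuting_conj[of q "q \<otimes> q"] by (metis m_assoc m_closed)
  moreover have "fst (\<beta> p) = 1" "fst (\<beta> q) = 1"
    using square_in_lattice_imp_sign assms(1) p q by auto
  ultimately show False by auto
qed

text \<open>The relations are symmetric in \<open>x\<close>, \<open>y\<close> and \<open>z = x y\<close>. By \<open>square_inverting\<close> and the preceding lemma all
  three fourth powers lie in the lattice. They require coordinates on which \<open>(x, y)\<close> acts with the signs
  \<open>(+, -)\<close>, \<open>(-, +)\<close> and \<open>(-, -)\<close>, but there are only two coordinates.\<close>

theorem no_mutually_inverting_squares: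
  assumes "even h" and x: "x \<in> carrier G" "x \<noteq> \<one>" and y: "y \<in> carrier G" "y \<noteq> \<one>"
    and xy: "x \<otimes> y \<noteq> \<one>"
    and x_inverts: "x \<otimes> (y \<otimes> y) \<otimes> inv x = inv (y \<otimes> y)"
    and y_inverts: "y \<otimes> (x \<otimes> x) \<otimes> inv y = inv (x \<otimes> x)"
  shows False
proof -
  define z where "z = x \<otimes> y"
  have z: "z \<in> carrier G" "z \<noteq> \<one>" using x y xy by (simp_all add: z_def)
  have cancel: "g \<otimes> (inv g \<otimes> w) = w" "inv g \<otimes> (g \<otimes> w) = w"
    if "g \<in> carrier G" "w \<in> carrier G" for g w
    using that by (simp_all add: m_assoc[symmetric])
  have inverting: "g \<otimes> u \<otimes> inv g = inv u"
    if "g \<in> carrier G" "u \<in> carrier G" "u \<otimes> (g \<otimes> u) = g" for g u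
  proof -
    have "g \<otimes> u = inv u \<otimes> g" using that by (metis cancel(2) m_closed)
    then show ?thesis using that by (simp add: m_assoc)
  qed
  have move: "g \<otimes> (k \<otimes> (k \<otimes> w)) = inv k \<otimes> (inv k \<otimes> (g \<otimes> w))"
    "inv g \<otimes> (k \<otimes> (k \<otimes> w)) = inv k \<otimes> (inv k \<otimes> (inv g \<otimes> w))"
    if gk: "g \<in> carrier G" "k \<in> carrier G" "g \<otimes> (k \<otimes> k) \<otimes> inv g = inv (k \<otimes> k)" and w: "w \<in> carrier G" for g k w
  proof -
    have 1: "g \<otimes> (k \<otimes> k) = inv (k \<otimes> k) \<otimes> g"
      using gk by (metis inv_solve_right' m_closed inv_closed)
    then have "g \<otimes> (k \<otimes> k) \<otimes> w = inv (k \<otimes> k) \<otimes> g \<otimes> w" by simp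
    then show *: "g \<otimes> (k \<otimes> (k \<otimes> w)) = inv k \<otimes> (inv k \<otimes> (g \<otimes> w))"
      using gk w by (simp add: m_assoc inv_mult_group)
    have "k \<otimes> (k \<otimes> w) = g \<otimes> (inv k \<otimes> (inv k \<otimes> (inv g \<otimes> w)))"
    proof -
      have "inv (k \<otimes> k) \<otimes> (g \<otimes> (inv (k \<otimes> k) \<otimes> (inv g \<otimes> w))) = w"
        using gk w by (simp add: m_assoc[symmetric] flip: 1) (simp add: m_assoc)
      then have "g \<otimes> (inv (k \<otimes> k) \<otimes> (inv g \<otimes> w)) = k \<otimes> k \<otimes> w"
        using gk w by (metis cancel(1) m_closed inv_closed)
      then show ?thesis using gk w by (simp add: m_assoc inv_mult_group)
    qed
    then show "inv g \<otimes> (k \<otimes> (k \<otimes> w)) = inv k \<otimes> (inv k \<otimes> (inv g \<otimes> w))"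
      using gk w by (simp add: cancel)
  qed
  have move_end: "g \<otimes> (k \<otimes> k) = inv k \<otimes> (inv k \<otimes> g)"
    if "g \<in> carrier G" "k \<in> carrier G" "g \<otimes> (k \<otimes> k) \<otimes> inv g = inv (k \<otimes> k)" for g k
    using move(1)[OF that one_closed] that by simp
  (* These rules move squares to the left and decide the word identities for z. *)
  note rules = cancel move[OF x(1) y(1) x_inverts] move[OF y(1) x(1) y_inverts]
    move_end[OF x(1) y(1) x_inverts] move_end[OF y(1) x(1) y_inverts]
  have x_z: "x \<otimes> (z \<otimes> z) \<otimes> inv x = inv (z \<otimes> z)"
    by (rule inverting) (use x y in \<open>simp_all add: z_def m_assoc rules\<close>)
  have y_z: "y \<otimes> (z \<otimes> z) \<otimes> inv y = inv (z \<otimes> z)"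
    by (rule inverting) (use x y in \<open>simp_all add: z_def m_assoc rules\<close>)
  have z_x: "z \<otimes> (x \<otimes> x) \<otimes> inv z = inv (x \<otimes> x)"
    by (rule inverting) (use x y in \<open>simp_all add: z_def m_assoc rules\<close>)
  have z_y: "z \<otimes> (y \<otimes> y) \<otimes> inv z = inv (y \<otimes> y)"
    by (rule inverting) (use x y in \<open>simp_all add: z_def m_assoc rules\<close>)
  have x4: "(x \<otimes> x) \<otimes> (x \<otimes> x) \<in> lattice"
  proof (rule ccontr)
    assume "(x \<otimes> x) \<otimes> (x \<otimes> x) \<notin> lattice"
    then have "y \<otimes> y \<in> lattice" "z \<otimes> z \<in> lattice"
      using square_inverting[of _ "x \<otimes> x"] x y z y_inverts z_x by simp_all
    then show False
      using no_inverting_pair_in_lattice[of y z] assms(1) y z y_z z_y by blast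
  qed
  have y4: "(y \<otimes> y) \<otimes> (y \<otimes> y) \<in> lattice"
  proof (rule ccontr)
    assume "(y \<otimes> y) \<otimes> (y \<otimes> y) \<notin> lattice"
    then have "x \<otimes> x \<in> lattice" "z \<otimes> z \<in> lattice"
      using square_inverting[of _ "y \<otimes> y"] x y z x_inverts z_y by simp_all
    then show False
      using no_inverting_pair_in_lattice[of x z] assms(1) x z x_z z_x by blast
  qed
  have z4: "(z \<otimes> z) \<otimes> (z \<otimes> z) \<in> lattice"
  proof (rule ccontr)
    assume "(z \<otimes> z) \<otimes> (z \<otimes> z) \<notin> lattice"
    then have "x \<otimes> x \<in> lattice" "y \<otimes> y \<in> lattice"
      using square_inverting[of _ "z \<otimes> z"] x y z x_z y_z by simp_all
    then show False
      using no_inverting_pair_in_lattice[of x y] assms(1) x y x_inverts y_inverts by blast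
  qed
  have fourth: "(g \<otimes> g) \<otimes> (g \<otimes> g) \<noteq> \<one>" "g \<otimes> ((g \<otimes> g) \<otimes> (g \<otimes> g)) \<otimes> inv g = (g \<otimes> g) \<otimes> (g \<otimes> g)"
    if "g \<in> carrier G" "g \<noteq> \<one>" for g
    using that square_neq_one[OF _ square_neq_one[OF that]]
      commuting_conj[of g "(g \<otimes> g) \<otimes> (g \<otimes> g)"] by (simp_all add: m_assoc)
  obtain f where f: "f \<in> {\<alpha>, \<beta>}" "fst (f x) = 1" "fst (f y) = -1"
    using lattice_character[OF x4 fourth(1)[OF x]] x y fourth(2)[OF x]
      inverting_square[of y "x \<otimes> x"] y_inverts by (metis m_closed)
  obtain f' where f': "f' \<in> {\<alpha>, \<beta>}" "fst (f' x) = -1" "fst (f' y) = 1"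
    using lattice_character[OF y4 fourth(1)[OF y]] x y fourth(2)[OF y]
      inverting_square[of x "y \<otimes> y"] x_inverts by (metis m_closed)
  obtain f'' where f'': "f'' \<in> {\<alpha>, \<beta>}" "fst (f'' x) = -1" "fst (f'' y) = -1"
    using lattice_character[OF z4 fourth(1)[OF z]] x y z
      inverting_square[of x "z \<otimes> z"] inverting_square[of y "z \<otimes> z"] x_z y_z by (metis m_closed)
  from f f' f'' show False by auto
qed

end


section \<open>The groups themselves\<close>

definition P_k_gen :: "nat \<Rightarrow> gens_ab \<Rightarrow> gens_ab word set set" where
  "P_k_gen k g = pres_gen (P_k_relators k) g"

lemma P_k_gen_in_carrier: "P_k_gen k g \<in> carrier (P_k k)"
  unfolding P_k_gen_def P_k_def by (rule pres_gen_in_carrier[OF P_k_relators_in_carrier])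

lemma P_k_relations:
  fixes k :: nat
  defines "a \<equiv> P_k_gen k gen_a" and "b \<equiv> P_k_gen k gen_b"
  shows "a \<otimes>\<^bsub>P_k k\<^esub> b [^]\<^bsub>P_k k\<^esub> ((2::nat) ^ k) \<otimes>\<^bsub>P_k k\<^esub> inv\<^bsub>P_k k\<^esub> a
      \<otimes>\<^bsub>P_k k\<^esub> b [^]\<^bsub>P_k k\<^esub> ((2::nat) ^ k) = \<one>\<^bsub>P_k k\<^esub>"
    and "b \<otimes>\<^bsub>P_k k\<^esub> a [^]\<^bsub>P_k k\<^esub> (2::nat) \<otimes>\<^bsub>P_k k\<^esub> inv\<^bsub>P_k k\<^esub> b
      \<otimes>\<^bsub>P_k k\<^esub> a [^]\<^bsub>P_k k\<^esub> (2::nat) = \<one>\<^bsub>P_k k\<^esub>"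
proof -
  let ?\<pi> = "\<lambda>x. normal_closure free_group (P_k_relators k) #>\<^bsub>free_group\<^esub> x"
  interpret \<pi>: group_hom free_group "P_k k" ?\<pi>
    using presented_group_proj_hom[OF P_k_relators_in_carrier, of k]
    by (intro group_hom.intro group_hom_axioms.intro group_free_group group_P_k)
      (simp add: P_k_def)
  have gens: "?\<pi> (free_gen gen_a) = a" "?\<pi> (free_gen gen_b) = b"
    by (simp_all add: a_def b_def P_k_gen_def pres_gen_def)
  have rel: "?\<pi> r = \<one>\<^bsub>P_k k\<^esub>" if "r \<in> P_k_relators k" for r
    using presented_group_relator[OF P_k_relators_in_carrier that] by (simp add: P_k_def)
  note [simp] = free_gen_in_carrier
  have in_relators: "free_gen gen_a \<otimes>\<^bsub>free_group\<^esub> free_gen gen_b [^]\<^bsub>free_group\<^esub> ((2::nat) ^ k) \<otimes>\<^bsub>free_group\<^esub> inv\<^bsub>free_group\<^esub> free_gen gen_a \<otimes>\<^bsub>free_group\<^esub> free_gen gen_b [^]\<^bsub>free_group\<^esub> ((2::nat) ^ k) \<in> P_k_relators k"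
    "free_gen gen_b \<otimes>\<^bsub>free_group\<^esub> free_gen gen_a [^]\<^bsub>free_group\<^esub> (2::nat) \<otimes>\<^bsub>free_group\<^esub> inv\<^bsub>free_group\<^esub> free_gen gen_b \<otimes>\<^bsub>free_group\<^esub> free_gen gen_a [^]\<^bsub>free_group\<^esub> (2::nat) \<in> P_k_relators k"
    by (simp_all add: P_k_relators_def Let_def)
  show "a \<otimes>\<^bsub>P_k k\<^esub> b [^]\<^bsub>P_k k\<^esub> ((2::nat) ^ k) \<otimes>\<^bsub>P_k k\<^esub> inv\<^bsub>P_k k\<^esub> a
      \<otimes>\<^bsub>P_k k\<^esub> b [^]\<^bsub>P_k k\<^esub> ((2::nat) ^ k) = \<one>\<^bsub>P_k k\<^esub>"
    unfolding gens[symmetric] using rel[OF in_relators(1)] by (simp add: \<pi>.hom_nat_pow)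
  show "b \<otimes>\<^bsub>P_k k\<^esub> a [^]\<^bsub>P_k k\<^esub> (2::nat) \<otimes>\<^bsub>P_k k\<^esub> inv\<^bsub>P_k k\<^esub> b
      \<otimes>\<^bsub>P_k k\<^esub> a [^]\<^bsub>P_k k\<^esub> (2::nat) = \<one>\<^bsub>P_k k\<^esub>"
    unfolding gens[symmetric] using rel[OF in_relators(2)] by (simp add: \<pi>.hom_nat_pow)
qed

lemma P_k_lift:
  assumes "group H" and x: "x \<in> carrier H" and y: "y \<in> carrier H"
    and "x \<otimes>\<^bsub>H\<^esub> y [^]\<^bsub>H\<^esub> ((2::nat) ^ k) \<otimes>\<^bsub>H\<^esub> inv\<^bsub>H\<^esub> x \<otimes>\<^bsub>H\<^esub> y [^]\<^bsub>H\<^esub> ((2::nat) ^ k) = \<one>\<^bsub>H\<^esub>"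
    and "y \<otimes>\<^bsub>H\<^esub> x [^]\<^bsub>H\<^esub> (2::nat) \<otimes>\<^bsub>H\<^esub> inv\<^bsub>H\<^esub> y \<otimes>\<^bsub>H\<^esub> x [^]\<^bsub>H\<^esub> (2::nat) = \<one>\<^bsub>H\<^esub>"
  obtains f where "f \<in> hom (P_k k) H" "f (P_k_gen k gen_a) = x" "f (P_k_gen k gen_b) = y"
proof -
  have "(case g of gen_a \<Rightarrow> x | gen_b \<Rightarrow> y) \<in> carrier H" for g
    using x y by (cases g) auto
  then obtain h where h: "h \<in> hom free_group H" "\<And>g. h (free_gen g) = (case g of gen_a \<Rightarrow> x | gen_b \<Rightarrow> y)"
    using group.free_group_lift[OF assms(1)] by metis
  interpret h: group_hom free_group H h
    by (intro group_hom.intro group_hom_axioms.intro group_free_group assms(1) h(1))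
  have "h r = \<one>\<^bsub>H\<^esub>" if "r \<in> P_k_relators k" for r
    using that assms(4,5)
    by (auto simp: P_k_relators_def Let_def h.hom_nat_pow h(2) free_gen_in_carrier)
  then show thesis
    using presented_group_lift[OF P_k_relators_in_carrier assms(1) h(1)] that h(2)
    unfolding P_k_def P_k_gen_def by (metis gens_ab.case)
qed

lemma P_k_generated: "generate (P_k k) {P_k_gen k gen_a, P_k_gen k gen_b} = carrier (P_k k)"
proof
  interpret group "P_k k" by (rule group_P_k)
  let ?S = "{P_k_gen k gen_a, P_k_gen k gen_b}"
  have S: "?S \<subseteq> carrier (P_k k)" by (simp add: P_k_gen_in_carrier)
  show "generate (P_k k) ?S \<subseteq> carrier (P_k k)"
    by (rule generate_incl[OF S])
  have gen: "P_k_gen k g \<in> ?S" for g by (cases g) auto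
  show "carrier (P_k k) \<subseteq> generate (P_k k) ?S"
  proof
    fix x assume "x \<in> carrier (P_k k)"
    then show "x \<in> generate (P_k k) ?S"
      unfolding P_k_def
    proof (induction x rule: presented_group_induct[OF P_k_relators_in_carrier, consumes 1])
      case 1
      then show ?case by (rule generate.one)
    next
      case (2 g x)
      then show ?case
        using generate.eng[OF generate.incl[OF gen[of g]]] by (simp add: P_k_def P_k_gen_def)
    next
      case (3 g x)
      then show ?case
        using generate.eng[OF generate.inv[OF gen[of g]]] by (simp add: P_k_def P_k_gen_def)
    qed
  qed
qed

text \<open>All that is needed of \<open>P\<close>: its generators satisfy the relations, and they and their product are
  non-trivial, as the action on the integers by a reflection and a translation shows.\<close>

lemma P_relations_pair:
  obtains x y where "x \<in> carrier P_group" "y \<in> carrier P_group"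
    "x \<otimes>\<^bsub>P_group\<^esub> y [^]\<^bsub>P_group\<^esub> (2::nat) \<otimes>\<^bsub>P_group\<^esub> inv\<^bsub>P_group\<^esub> x
      \<otimes>\<^bsub>P_group\<^esub> y [^]\<^bsub>P_group\<^esub> (2::nat) = \<one>\<^bsub>P_group\<^esub>"
    "y \<otimes>\<^bsub>P_group\<^esub> x [^]\<^bsub>P_group\<^esub> (2::nat) \<otimes>\<^bsub>P_group\<^esub> inv\<^bsub>P_group\<^esub> y
      \<otimes>\<^bsub>P_group\<^esub> x [^]\<^bsub>P_group\<^esub> (2::nat) = \<one>\<^bsub>P_group\<^esub>"
    "x \<noteq> \<one>\<^bsub>P_group\<^esub>" "y \<noteq> \<one>\<^bsub>P_group\<^esub>" "x \<otimes>\<^bsub>P_group\<^esub> y \<noteq> \<one>\<^bsub>P_group\<^esub>"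
proof -
  let ?\<pi> = "\<lambda>x. normal_closure free_group P_relators #>\<^bsub>free_group\<^esub> x"
  define x y where xy_def: "x = ?\<pi> (free_gen gen_x)" "y = ?\<pi> (free_gen gen_y)"
  interpret \<pi>: group_hom free_group P_group ?\<pi>
    using presented_group_proj_hom[OF P_relators_in_carrier]
    by (intro group_hom.intro group_hom_axioms.intro group_free_group group_P_group)
      (simp add: P_group_def)
  note [simp] = free_gen_in_carrier
  have rel: "?\<pi> r = \<one>\<^bsub>P_group\<^esub>" if "r \<in> P_relators" for r
    using presented_group_relator[OF P_relators_in_carrier that] by (simp add: P_group_def)
  have "(case g of gen_x \<Rightarrow> (-1, 0) | gen_y \<Rightarrow> (1, 1)) \<in> carrier Aff" for g
    by (cases g) auto
  then obtain h where h: "h \<in> hom free_group Aff"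
    "\<And>g. h (free_gen g) = (case g of gen_x \<Rightarrow> (-1, 0) | gen_y \<Rightarrow> (1, 1))"
    using group.free_group_lift[OF group_Aff] by metis
  interpret h: group_hom free_group Aff h
    by (intro group_hom.intro group_hom_axioms.intro group_free_group group_Aff h(1))
  have inv: "inv\<^bsub>Aff\<^esub> (-1, 0) = (-1, 0)" "inv\<^bsub>Aff\<^esub> (1, 1) = (1, -1)"
    by (rule group.inv_equality[OF group_Aff]; simp add: Aff_one)+
  have "h r = \<one>\<^bsub>Aff\<^esub>" if "r \<in> P_relators" for r
    using that
    by (auto simp: P_relators_def Let_def h.hom_nat_pow h(2) inv numeral_2_eq_2 Aff_one)
  then obtain f where f: "f \<in> hom P_group Aff" "\<And>g. f (pres_gen P_relators g) = h (free_gen g)"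
    using presented_group_lift[OF P_relators_in_carrier group_Aff h(1)]
    unfolding P_group_def by metis
  interpret f: group_hom P_group Aff f
    by (intro group_hom.intro group_hom_axioms.intro group_P_group group_Aff f(1))
  have fxy: "f x = (-1, 0)" "f y = (1, 1)"
    using f(2)[of gen_x] f(2)[of gen_y] h(2) by (simp_all add: xy_def pres_gen_def)
  have xy: "x \<in> carrier P_group" "y \<in> carrier P_group"
    by (simp_all add: xy_def)
  have "f (x \<otimes>\<^bsub>P_group\<^esub> y) = (-1, -1)" using xy fxy by simp
  then have nontrivial: "x \<noteq> \<one>\<^bsub>P_group\<^esub>" "y \<noteq> \<one>\<^bsub>P_group\<^esub>" "x \<otimes>\<^bsub>P_group\<^esub> y \<noteq> \<one>\<^bsub>P_group\<^esub>"
    using fxy f.hom_one by (auto simp: Aff_one)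
  have in_relators: "free_gen gen_x \<otimes>\<^bsub>free_group\<^esub> free_gen gen_y [^]\<^bsub>free_group\<^esub> (2::nat) \<otimes>\<^bsub>free_group\<^esub> inv\<^bsub>free_group\<^esub> free_gen gen_x \<otimes>\<^bsub>free_group\<^esub> free_gen gen_y [^]\<^bsub>free_group\<^esub> (2::nat) \<in> P_relators"
    "free_gen gen_y \<otimes>\<^bsub>free_group\<^esub> free_gen gen_x [^]\<^bsub>free_group\<^esub> (2::nat) \<otimes>\<^bsub>free_group\<^esub> inv\<^bsub>free_group\<^esub> free_gen gen_y \<otimes>\<^bsub>free_group\<^esub> free_gen gen_x [^]\<^bsub>free_group\<^esub> (2::nat) \<in> P_relators"
    by (simp_all add: P_relators_def Let_def)
  have rels: "x \<otimes>\<^bsub>P_group\<^esub> y [^]\<^bsub>P_group\<^esub> (2::nat) \<otimes>\<^bsub>P_group\<^esub> inv\<^bsub>P_group\<^esub> x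
      \<otimes>\<^bsub>P_group\<^esub> y [^]\<^bsub>P_group\<^esub> (2::nat) = \<one>\<^bsub>P_group\<^esub>"
    "y \<otimes>\<^bsub>P_group\<^esub> x [^]\<^bsub>P_group\<^esub> (2::nat) \<otimes>\<^bsub>P_group\<^esub> inv\<^bsub>P_group\<^esub> y
      \<otimes>\<^bsub>P_group\<^esub> x [^]\<^bsub>P_group\<^esub> (2::nat) = \<one>\<^bsub>P_group\<^esub>"
    using rel[OF in_relators(1)] rel[OF in_relators(2)] by (simp_all add: xy_def \<pi>.hom_nat_pow)
  show thesis using that xy rels nontrivial by blast
qed

text \<open>Existence of the three homomorphisms is the universal property of the presentation; only the
  relators have to be evaluated.\<close>

lemma P_k_acting_on_plane:
  assumes "k > 0"
  obtains \<alpha> \<beta> \<phi>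
  where "acting_on_plane (P_k k) (P_k_gen k gen_a) (P_k_gen k gen_b) (2 ^ (k - 1)) \<alpha> \<beta> \<phi>"
proof -
  let ?h = "2 ^ (k - 1) :: int"
  have period: "2 * ?h = int (2 ^ k)"
    using assms by (cases k) auto
  interpret group "P_k k" by (rule group_P_k)
  note [simp] = P_k_gen_in_carrier
  have inverting: "u = inv\<^bsub>P_k k\<^esub> v"
    if "u \<otimes>\<^bsub>P_k k\<^esub> v = \<one>\<^bsub>P_k k\<^esub>" "u \<in> carrier (P_k k)" "v \<in> carrier (P_k k)" for u v
    using inv_equality[OF that(1,3,2)] by simp
  have int2: "x [^]\<^bsub>P_k k\<^esub> (2::int) = x [^]\<^bsub>P_k k\<^esub> (2::nat)" for x
    using int_pow_int[of "P_k k" x 2] by simp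
  have mutually: "mutually_inverting (P_k k) (P_k_gen k gen_a) (P_k_gen k gen_b) ?h"
  proof (intro mutually_inverting.intro mutually_inverting_axioms.intro is_group)
    have period': "x [^]\<^bsub>P_k k\<^esub> (2 * ?h) = x [^]\<^bsub>P_k k\<^esub> ((2::nat) ^ k)" for x
      unfolding period by (rule int_pow_int)
    show "P_k_gen k gen_a \<otimes>\<^bsub>P_k k\<^esub> P_k_gen k gen_b [^]\<^bsub>P_k k\<^esub> (2 * ?h) \<otimes>\<^bsub>P_k k\<^esub> inv\<^bsub>P_k k\<^esub> P_k_gen k gen_a
        = inv\<^bsub>P_k k\<^esub> (P_k_gen k gen_b [^]\<^bsub>P_k k\<^esub> (2 * ?h))"
      unfolding period' by (rule inverting[OF P_k_relations(1)]) simp_all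
    show "P_k_gen k gen_b \<otimes>\<^bsub>P_k k\<^esub> P_k_gen k gen_a [^]\<^bsub>P_k k\<^esub> (2::int) \<otimes>\<^bsub>P_k k\<^esub> inv\<^bsub>P_k k\<^esub> P_k_gen k gen_b
        = inv\<^bsub>P_k k\<^esub> (P_k_gen k gen_a [^]\<^bsub>P_k k\<^esub> (2::int))"
      unfolding int2 by (rule inverting[OF P_k_relations(2)]) simp_all
  qed simp_all
  have Aff_refl: "inv\<^bsub>Aff\<^esub> (-1, 0) = (-1, 0)"
    by (rule group.inv_equality[OF group_Aff]) (simp_all add: Aff_one)
  have Aff_trans: "inv\<^bsub>Aff\<^esub> (1, 1) = (1, -1)"
    by (rule group.inv_equality[OF group_Aff]) (simp_all add: Aff_one)
  have even: "(-1, 0) [^]\<^bsub>Aff\<^esub> ((2::nat) ^ k) = (1, 0)"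
    unfolding int_pow_int[symmetric] Aff_reflection_int_pow using assms by simp
  have square: "(-1, 0) [^]\<^bsub>Aff\<^esub> (2::nat) = (1, 0)"
    "(0, -2, 1 / 2, 0) [^]\<^bsub>SL2\<^esub> (2::nat) = neg_one"
    by (simp_all add: numeral_2_eq_2 nat_pow_def Aff_one SL2_one)
  obtain \<alpha> where \<alpha>: "\<alpha> \<in> hom (P_k k) Aff" "\<alpha> (P_k_gen k gen_a) = (-1, 0)" "\<alpha> (P_k_gen k gen_b) = (1, 1)"
    by (rule P_k_lift[OF group_Aff, of "(-1, 0)" "(1, 1)" k])
      (auto simp: Aff_translation_nat_pow Aff_refl Aff_trans Aff_one square)
  obtain \<beta> where \<beta>: "\<beta> \<in> hom (P_k k) Aff" "\<beta> (P_k_gen k gen_a) = (1, 1)" "\<beta> (P_k_gen k gen_b) = (-1, 0)"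
    by (rule P_k_lift[OF group_Aff, of "(1, 1)" "(-1, 0)" k])
      (auto simp: Aff_translation_nat_pow Aff_refl Aff_trans even Aff_one)
  let ?t = "pi / of_int (2 * ?h)"
  have "(2::nat) \<le> 2 ^ k"
    using assms by (cases k) auto
  then have b_pow: "elliptic ?t [^]\<^bsub>SL2\<^esub> ((2::nat) ^ k) = neg_one"
    unfolding period by (metis elliptic_pow_period of_int_of_nat_eq)
  obtain \<phi> where \<phi>: "\<phi> \<in> hom (P_k k) SL2" "\<phi> (P_k_gen k gen_a) = (0, -2, 1 / 2, 0)"
    "\<phi> (P_k_gen k gen_b) = elliptic ?t"
    by (rule P_k_lift[OF group_SL2, of "(0, -2, 1 / 2, 0)" "elliptic ?t" k])
      (simp_all only: b_pow square, simp_all add: elliptic_def SL2_inv SL2_one)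
  show thesis
    using that mutually \<alpha> \<beta> \<phi> P_k_generated
    by (simp add: acting_on_plane_def acting_on_plane_axioms_def acting_on_lines_def
        acting_on_lines_axioms_def)
qed

theorem theorem2:
  shows "(\<forall>k::nat. k > 0 \<longrightarrow> torsion_free (P_k k) \<and> \<not> unique_product_property (P_k k)) \<and>
         (\<forall>k::nat. k > 1 \<longrightarrow> \<not> (\<exists>H. subgroup H (P_k k) \<and> (P_k k)\<lparr>carrier := H\<rparr> \<cong> P_group))"
proof (intro conjI allI impI notI)
  fix k :: nat assume "k > 0"
  then obtain \<alpha> \<beta> \<phi>
    where "acting_on_plane (P_k k) (P_k_gen k gen_a) (P_k_gen k gen_b) (2 ^ (k - 1)) \<alpha> \<beta> \<phi>"
    by (rule P_k_acting_on_plane)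
  then interpret acting_on_plane "P_k k" "P_k_gen k gen_a" "P_k_gen k gen_b" "2 ^ (k - 1)" \<alpha> \<beta> \<phi> .
  show "torsion_free (P_k k)" by (rule torsion_free)
  show "unique_product_property (P_k k) \<Longrightarrow> False" using not_unique_product by blast
next
  fix k :: nat assume k: "k > 1"
    and "\<exists>H. subgroup H (P_k k) \<and> (P_k k)\<lparr>carrier := H\<rparr> \<cong> P_group"
  then obtain H where H: "subgroup H (P_k k)" "(P_k k)\<lparr>carrier := H\<rparr> \<cong> P_group" by blast
  from k have "k > 0" by simp
  then obtain \<alpha> \<beta> \<phi>
    where "acting_on_plane (P_k k) (P_k_gen k gen_a) (P_k_gen k gen_b) (2 ^ (k - 1)) \<alpha> \<beta> \<phi>"
    by (rule P_k_acting_on_plane)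
  then interpret acting_on_plane "P_k k" "P_k_gen k gen_a" "P_k_gen k gen_b" "2 ^ (k - 1)" \<alpha> \<beta> \<phi> .
  have "P_group \<cong> (P_k k)\<lparr>carrier := H\<rparr>"
    by (rule group.iso_sym[OF subgroup.subgroup_is_group[OF H(1) is_group] H(2)])
  then obtain f where f: "f \<in> iso P_group ((P_k k)\<lparr>carrier := H\<rparr>)"
    by (auto simp: is_iso_def)
  then have hom: "f \<in> hom P_group (P_k k)" and inj: "inj_on f (carrier P_group)"
    using subgroup.subset[OF H(1)] by (auto simp: iso_def hom_def bij_betw_def)
  interpret f: group_hom P_group "P_k k" f
    by (intro group_hom.intro group_hom_axioms.intro group_P_group is_group hom)
  obtain x y where xy: "x \<in> carrier P_group" "y \<in> carrier P_group"
    "x \<otimes>\<^bsub>P_group\<^esub> y [^]\<^bsub>P_group\<^esub> (2::nat) \<otimes>\<^bsub>P_group\<^esub> inv\<^bsub>P_group\<^esub> x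
      \<otimes>\<^bsub>P_group\<^esub> y [^]\<^bsub>P_group\<^esub> (2::nat) = \<one>\<^bsub>P_group\<^esub>"
    "y \<otimes>\<^bsub>P_group\<^esub> x [^]\<^bsub>P_group\<^esub> (2::nat) \<otimes>\<^bsub>P_group\<^esub> inv\<^bsub>P_group\<^esub> y
      \<otimes>\<^bsub>P_group\<^esub> x [^]\<^bsub>P_group\<^esub> (2::nat) = \<one>\<^bsub>P_group\<^esub>"
    "x \<noteq> \<one>\<^bsub>P_group\<^esub>" "y \<noteq> \<one>\<^bsub>P_group\<^esub>" "x \<otimes>\<^bsub>P_group\<^esub> y \<noteq> \<one>\<^bsub>P_group\<^esub>"
    by (rule P_relations_pair)
  have neq: "f u \<noteq> \<one>\<^bsub>P_k k\<^esub>" if "u \<in> carrier P_group" "u \<noteq> \<one>\<^bsub>P_group\<^esub>" for u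
    using inj_onD[OF inj, of u "\<one>\<^bsub>P_group\<^esub>"] that by auto
  have inverts: "f u \<otimes>\<^bsub>P_k k\<^esub> (f v \<otimes>\<^bsub>P_k k\<^esub> f v) \<otimes>\<^bsub>P_k k\<^esub> inv\<^bsub>P_k k\<^esub> f u
      = inv\<^bsub>P_k k\<^esub> (f v \<otimes>\<^bsub>P_k k\<^esub> f v)"
    if uv: "u \<in> carrier P_group" "v \<in> carrier P_group"
      "u \<otimes>\<^bsub>P_group\<^esub> v [^]\<^bsub>P_group\<^esub> (2::nat) \<otimes>\<^bsub>P_group\<^esub> inv\<^bsub>P_group\<^esub> u
        \<otimes>\<^bsub>P_group\<^esub> v [^]\<^bsub>P_group\<^esub> (2::nat) = \<one>\<^bsub>P_group\<^esub>" for u v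
  proof -
    have "f (u \<otimes>\<^bsub>P_group\<^esub> v [^]\<^bsub>P_group\<^esub> (2::nat) \<otimes>\<^bsub>P_group\<^esub> inv\<^bsub>P_group\<^esub> u
        \<otimes>\<^bsub>P_group\<^esub> v [^]\<^bsub>P_group\<^esub> (2::nat)) = \<one>\<^bsub>P_k k\<^esub>"
      using uv by simp
    then have "f u \<otimes>\<^bsub>P_k k\<^esub> (f v \<otimes>\<^bsub>P_k k\<^esub> f v) \<otimes>\<^bsub>P_k k\<^esub> inv\<^bsub>P_k k\<^esub> f u
        \<otimes>\<^bsub>P_k k\<^esub> (f v \<otimes>\<^bsub>P_k k\<^esub> f v) = \<one>\<^bsub>P_k k\<^esub>"
      using uv by (simp add: numeral_2_eq_2)
    then show ?thesis
      using uv by (intro inv_equality[symmetric]) auto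
  qed
  have "even ((2::int) ^ (k - 1))" using k by simp
  then show False
    using no_mutually_inverting_squares[of "f x" "f y"] inverts[OF xy(1,2,3)] inverts[OF xy(2,1,4)]
      neq[OF xy(1,5)] neq[OF xy(2,6)] neq[of "x \<otimes>\<^bsub>P_group\<^esub> y"] xy by simp
qed

end
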